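(* Let $V$ be a finite set, let $\Sigma$ be the set of all mappings from $V$ to itself, let $\mu$ be a probability law on $\Sigma$ and suppose that the directed graph induced by $\mu$ is of constant outdegree, strongly-connected and aperiodic. Then the following assertions hold: (i) There exists a $\mu$-random walk $\{X,N\}$ in $V$. (ii) The $\mu$-random walk is unique up to identity in law. (iii) The $\mu$-random walk $\{X,N\}$ is stationary. (iv) The common law $\lambda$ of $X=(X_k)_{k\in\mathbb{Z}}$ is the unique probability law on $V$ satisfying $\mu*\lambda=\lambda$. (v) The tail $\sigma$-field $\bigcap_{k\in\mathbb{Z}}\sigma(X_j,N_j:j\le k)$ is a.s. trivial.
   Context: $\Sigma$ acts on $V$ by evaluation; $\mathrm{Supp}(\mu)=\{\sigma\in\Sigma:\mu(\sigma)>0\}$. The directed graph induced by $\mu$ is $(V,A)$ with $A(y,x)=\#\{\sigma\in\mathrm{Supp}(\mu):\sigma x=y\}$, $y,x\in V$. It is of constant outdegree if $\sum_yA(y,x)$ does not depend on $x$ (automatic here); strongly-connected if for all $y,x\in V$ there is $n\ge1$ with $A^n(y,x)\ge1$; aperiodic if $\gcd\{n\ge1:A^n(x,x)\ge1\}=1$ for all $x\in V$. A $\mu$-random walk is a pair $\{X,N\}$ of processes $X=(X_k)_{k\in\mathbb{Z}}$ with values in $V$ and $N=(N_k)_{k\in\mathbb{Z}}$ with values in $\Sigma$, on a common probability space, such that: (1) $N_k$ is independent of $\sigma(X_j,N_j:j\le k-1)$ for each $k\in\mathbb{Z}$; (2) $(N_k)_{k\in\mathbb{Z}}$ is i.i.d.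 with common law $\mu$; (3) $X_k=N_kX_{k-1}$ a.s. for each $k\in\mathbb{Z}$. Two pairs $\{X,N\}$, $\{X',N'\}$ are identical in law if $((X_k)_{k\in\mathbb{Z}},(N_k)_{k\in\mathbb{Z}})$ and $((X'_k)_{k\in\mathbb{Z}},(N'_k)_{k\in\mathbb{Z}})$ have the same law. $\{X,N\}$ is stationary if for every $n\in\mathbb{Z}$ it is identical in law to $\{(X_{k+n})_{k\in\mathbb{Z}},(N_{k+n})_{k\in\mathbb{Z}}\}$. Convolution: $(\mu*\lambda)(y)=\sum_{\sigma\in\Sigma}\mu(\sigma)\sum_{x\in V}\lambda(x)1_{\{\sigma x=y\}}$, $y\in V$. *)

theory Defs
  imports "HOL-Probability.Probability"
begin

text \<open>
  The finite set \<open>V\<close> is the universe of a type \<open>'v :: finite\<close> (nonempty, as it must be to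
  carry a random walk), so that \<open>\<Sigma>\<close>, the set of all self-maps of \<open>V\<close>, is the
  universe of \<open>'v \<Rightarrow> 'v\<close>, and a probability law on \<open>\<Sigma>\<close> is a \<open>('v \<Rightarrow> 'v) pmf\<close>.
  Every subset of \<open>V\<close> and of \<open>\<Sigma>\<close> is measurable.

  A directed graph is given by its adjacency matrix \<open>A\<close>, where \<open>A $ y $ x\<close> is the number of
  edges from \<open>x\<close> to \<open>y\<close>.
\<close>

definition induced_graph :: "('v::finite \<Rightarrow> 'v) pmf \<Rightarrow> nat ^ 'v ^ 'v" where
  "induced_graph \<mu> = (\<chi> y x. card {\<sigma> \<in> set_pmf \<mu>. \<sigma> x = y})"

text \<open>The overloaded \<open>A ^ n\<close> on \<open>nat ^ 'v ^ 'v\<close> is the componentwise power, not the matrix power.\<close>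

primrec matrix_power :: "nat ^ 'v ^ 'v \<Rightarrow> nat \<Rightarrow> nat ^ 'v ^ ('v::finite)" where
  "matrix_power A 0 = mat 1"
| "matrix_power A (Suc n) = A ** matrix_power A n"

definition constant_outdegree :: "nat ^ 'v ^ ('v::finite) \<Rightarrow> bool" where
  "constant_outdegree A \<longleftrightarrow> (\<exists>d. \<forall>x. (\<Sum>y\<in>UNIV. A $ y $ x) = d)"

definition strongly_connected :: "nat ^ 'v ^ ('v::finite) \<Rightarrow> bool" where
  "strongly_connected A \<longleftrightarrow> (\<forall>y x. \<exists>n\<ge>1. matrix_power A n $ y $ x \<ge> 1)"

definition aperiodic :: "nat ^ 'v ^ ('v::finite) \<Rightarrow> bool" where
  "aperiodic A \<longleftrightarrow> (\<forall>x. Gcd {n. n \<ge> 1 \<and> matrix_power A n $ x $ x \<ge> 1} = 1)"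

text \<open>The \<open>\<sigma>\<close>-field generated by \<open>X j\<close> and \<open>N j\<close> for all \<open>j \<le> k\<close>.\<close>

definition past :: "'a measure \<Rightarrow> (int \<Rightarrow> 'a \<Rightarrow> 'v) \<Rightarrow> (int \<Rightarrow> 'a \<Rightarrow> 'v \<Rightarrow> 'v) \<Rightarrow> int \<Rightarrow> 'a set set" where
  "past M X N k = sigma_sets (space M)
     (\<Union>j\<in>{..k}. {X j -` B \<inter> space M | B. B \<in> UNIV} \<union> {N j -` C \<inter> space M | C. C \<in> UNIV})"

definition tail_field :: "'a measure \<Rightarrow> (int \<Rightarrow> 'a \<Rightarrow> 'v) \<Rightarrow> (int \<Rightarrow> 'a \<Rightarrow> 'v \<Rightarrow> 'v) \<Rightarrow> 'a set set" where
  "tail_field M X N = (\<Inter>k. past M X N k)"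

definition random_walk ::
  "('v::finite \<Rightarrow> 'v) pmf \<Rightarrow> 'a measure \<Rightarrow> (int \<Rightarrow> 'a \<Rightarrow> 'v) \<Rightarrow> (int \<Rightarrow> 'a \<Rightarrow> 'v \<Rightarrow> 'v) \<Rightarrow> bool" where
  "random_walk \<mu> M X N \<longleftrightarrow>
     prob_space M \<and>
     (\<forall>k. X k \<in> measurable M (count_space UNIV)) \<and>
     (\<forall>k. N k \<in> measurable M (count_space UNIV)) \<and>
     (\<forall>k. prob_space.indep_set M {N k -` C \<inter> space M | C. C \<in> UNIV} (past M X N (k - 1))) \<and>
     prob_space.indep_vars M (\<lambda>_. count_space UNIV) N UNIV \<and>
     (\<forall>k. distr M (count_space UNIV) (N k) = measure_pmf \<mu>) \<and>
     (\<forall>k. AE \<omega> in M. X k \<omega> = N k \<omega> (X (k - 1) \<omega>))"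

definition joint_law ::
  "'a measure \<Rightarrow> (int \<Rightarrow> 'a \<Rightarrow> 'v) \<Rightarrow> (int \<Rightarrow> 'a \<Rightarrow> 'v \<Rightarrow> 'v) \<Rightarrow> ((int \<Rightarrow> 'v) \<times> (int \<Rightarrow> 'v \<Rightarrow> 'v)) measure" where
  "joint_law M X N =
     distr M ((\<Pi>\<^sub>M k\<in>UNIV. count_space UNIV) \<Otimes>\<^sub>M (\<Pi>\<^sub>M k\<in>UNIV. count_space UNIV))
       (\<lambda>\<omega>. (\<lambda>k. X k \<omega>, \<lambda>k. N k \<omega>))"

definition identical_in_law ::
  "'a measure \<Rightarrow> (int \<Rightarrow> 'a \<Rightarrow> 'v) \<Rightarrow> (int \<Rightarrow> 'a \<Rightarrow> 'v \<Rightarrow> 'v) \<Rightarrow>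
   'b measure \<Rightarrow> (int \<Rightarrow> 'b \<Rightarrow> 'v) \<Rightarrow> (int \<Rightarrow> 'b \<Rightarrow> 'v \<Rightarrow> 'v) \<Rightarrow> bool" where
  "identical_in_law M X N M' X' N' \<longleftrightarrow> joint_law M X N = joint_law M' X' N'"

definition stationary ::
  "'a measure \<Rightarrow> (int \<Rightarrow> 'a \<Rightarrow> 'v) \<Rightarrow> (int \<Rightarrow> 'a \<Rightarrow> 'v \<Rightarrow> 'v) \<Rightarrow> bool" where
  "stationary M X N \<longleftrightarrow>
     (\<forall>n. identical_in_law M X N M (\<lambda>k. X (k + n)) (\<lambda>k. N (k + n)))"

definition conv_law :: "('v::finite \<Rightarrow> 'v) pmf \<Rightarrow> 'v pmf \<Rightarrow> 'v \<Rightarrow> real" where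
  "conv_law \<mu> \<nu> y =
     (\<Sum>\<sigma>\<in>UNIV. pmf \<mu> \<sigma> * (\<Sum>x\<in>UNIV. pmf \<nu> x * indicator {x. \<sigma> x = y} x))"

end

theory Submission
  imports Defs
begin

text \<open>
  The positions form a Markov chain with kernel \<open>x \<mapsto> law of \<sigma> x\<close>, which is irreducible and
  aperiodic, so its \<open>n\<close>-step probabilities converge to a law \<open>\<nu>\<close> not depending on the starting
  point. Letting the starting time tend to \<open>-\<infinity>\<close> shows that for a tail event \<open>F\<close> and any time
  \<open>k\<close>, \<open>P (F \<inter> {X k = y}) = P F * \<nu> y\<close>. Together with the Markov property of
  \<open>k \<mapsto> (X k, N k)\<close> this determines the measure \<open>P (F \<inter> _)\<close> on all path cylinders, in a form that does
  not change under time shifts. Taking \<open>F\<close> to be the whole space gives uniqueness, stationarity and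
  the law of \<open>X k\<close>; comparing a general \<open>F\<close> with the whole space shows that \<open>F\<close> is independent of
  the path and hence of itself. For existence, the one-step kernel started in equilibrium has
  consistent window laws, so Kolmogorov's extension theorem applies.
\<close>

section \<open>Convergence of finite Markov chains\<close>

text \<open>A two-sided walk has no first time, so no initial law is given: the definition does not
  say how \<open>X k\<close> is distributed, nor that it is independent of the tail. Both must be
  extracted from mixing, uniformly in the unknown law of the position at a remote time; on a finite
  state space, convergence from each single point suffices for that. Mixing is proved for positions
  only. The pair chain need not be irreducible on all pairs, because maps outside the support of
  \<open>\<mu>\<close> are never chosen, but its next step reads the current pair only through the
  position. Walks to be compared may live on unrelated probability spaces, so each one is compared
  with a single reference law \<open>L\<close> on paths of pairs; the coordinates under this same
  \<open>L\<close> are the walk that proves existence. The restriction of the probability to a tail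
  event is left unnormalised, so that events of probability 0 are no special case.\<close>

lemma consecutive_elements_if_Gcd_1:
  fixes S :: "nat set"
  assumes zero: "0 \<in> S" and add: "\<And>a b. a \<in> S \<Longrightarrow> b \<in> S \<Longrightarrow> a + b \<in> S" and gcd: "Gcd S = 1"
  shows "\<exists>b\<in>S. Suc b \<in> S"
proof -
  have mult: "k * a \<in> S" if "a \<in> S" for k a
    using that by (induction k) (auto intro: zero add)
  define D where "D = {d. 0 < d \<and> (\<exists>b\<in>S. b + d \<in> S)}"
  have "\<exists>s\<in>S. s > 0"
  proof (rule ccontr)
    assume "\<not> ?thesis"
    then have "S = {0}" using zero by auto
    with gcd show False by simp
  qed
  then have "\<exists>d. d \<in> D" unfolding D_def using zero by force
  define d where "d = (LEAST d. d \<in> D)"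
  have dD: "d \<in> D" unfolding d_def using \<open>\<exists>d. d \<in> D\<close> by (rule LeastI_ex)
  have least: "d \<le> d'" if "d' \<in> D" for d' unfolding d_def using that by (rule Least_le)
  from dD obtain b where d0: "0 < d" and b: "b \<in> S" "b + d \<in> S" by (auto simp: D_def)
  \<comment> \<open>If \<open>s\<close> left a positive remainder modulo the least positive
    difference \<open>d\<close>, then \<open>q * (b + d)\<close> and \<open>s + q * b\<close>, with
    \<open>q = s div d\<close>, would be elements of \<open>S\<close> differing by exactly that
    smaller remainder.\<close>
  have "d dvd s" if s: "s \<in> S" for s
  proof (rule ccontr)
    assume "\<not> d dvd s"
    then have r: "0 < s mod d" by (simp add: mod_greater_zero_iff_not_dvd)
    let ?q = "s div d"
    have "?q * (b + d) \<in> S" "s + ?q * b \<in> S" using b s by (auto intro: mult add)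
    moreover have "?q * (b + d) + s mod d = s + ?q * b"
      by (simp add: algebra_simps)
    ultimately have "\<exists>b\<in>S. b + s mod d \<in> S" by metis
    with r have "s mod d \<in> D" by (simp add: D_def)
    with least have "d \<le> s mod d" by blast
    with d0 show False by (metis leD mod_less_divisor)
  qed
  then have "d dvd Gcd S" by (rule Gcd_greatest)
  with gcd have "d = 1" by simp
  with b show ?thesis by auto
qed

text \<open>With \<open>b\<close> and \<open>b + 1\<close> in \<open>S\<close>, any \<open>n\<close>
  whose quotient by \<open>b\<close> is at least its remainder \<open>r\<close> is a sum of
  \<open>r\<close> copies of \<open>b + 1\<close> and \<open>n div b - r\<close> copies of
  \<open>b\<close>. From \<open>b * b\<close> on this is always the case.\<close>

lemma add_closed_Gcd_1_cofinite:
  fixes S :: "nat set"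
  assumes zero: "0 \<in> S" and add: "\<And>a b. a \<in> S \<Longrightarrow> b \<in> S \<Longrightarrow> a + b \<in> S" and gcd: "Gcd S = 1"
  shows "\<exists>N. \<forall>n\<ge>N. n \<in> S"
proof -
  have mult: "k * a \<in> S" if "a \<in> S" for k a
    using that by (induction k) (auto intro: zero add)
  obtain b where b: "b \<in> S" "Suc b \<in> S"
    using consecutive_elements_if_Gcd_1[OF assms] by blast
  show ?thesis
  proof (cases "b = 0")
    case True
    then have "n \<in> S" for n using mult[of 1 n] b by simp
    then show ?thesis by blast
  next
    case False
    have "n \<in> S" if "n \<ge> b * b" for n
    proof -
      have "n mod b \<le> n div b"
      proof -
        have "b \<le> n div b" using that False by (simp add: less_eq_div_iff_mult_less_eq)
        moreover have "n mod b < b" using False by simp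
        ultimately show ?thesis by linarith
      qed
      then obtain c where c: "n div b = n mod b + c" using le_Suc_ex by blast
      have "n = (n div b) * b + n mod b" by simp
      also have "\<dots> = c * b + (n mod b) * Suc b" unfolding c by (simp add: algebra_simps)
      finally show ?thesis using mult b add by metis
    qed
    then show ?thesis by blast
  qed
qed

section \<open>Transition operators and n-step probabilities\<close>

text \<open>The Markov operator on functions: the expectation of \<open>f\<close> after one step
  from \<open>x\<close>. This action, dual to the one on laws, averages values and thus can shrink
  the oscillation of \<open>f\<close>.\<close>

definition kernel_op :: "('s::finite \<Rightarrow> 's pmf) \<Rightarrow> ('s \<Rightarrow> real) \<Rightarrow> 's \<Rightarrow> real" where
  "kernel_op K f x = (\<Sum>y\<in>UNIV. pmf (K x) y * f y)"

lemma kernel_op_mono: "(\<And>x. f x \<le> g x) \<Longrightarrow> kernel_op K f x \<le> kernel_op K g x"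
  unfolding kernel_op_def by (intro sum_mono mult_left_mono) auto

lemma kernel_op_const: "kernel_op K (\<lambda>_. c) = (\<lambda>_. c)"
  unfolding kernel_op_def by (simp add: sum_distrib_right[symmetric] sum_pmf_eq_1)

lemma kernel_op_cmult: "kernel_op K (\<lambda>x. c * f x) = (\<lambda>x. c * kernel_op K f x)"
  unfolding kernel_op_def by (simp add: sum_distrib_left mult_ac)

lemma kernel_op_sum: "kernel_op K (\<lambda>x. \<Sum>i\<in>I. f i x) = (\<lambda>x. \<Sum>i\<in>I. kernel_op K (f i) x)"
  unfolding kernel_op_def sum_distrib_left by (subst sum.swap) simp

lemma funpow_kernel_op_mono:
  "(\<And>x. f x \<le> g x) \<Longrightarrow> (kernel_op K ^^ n) f x \<le> (kernel_op K ^^ n) g x"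
  by (induction n arbitrary: x) (auto intro: kernel_op_mono)

lemma funpow_kernel_op_const: "(kernel_op K ^^ n) (\<lambda>_. c) = (\<lambda>_. c)"
  by (induction n) (auto simp: kernel_op_const)

lemma funpow_kernel_op_cmult: "(kernel_op K ^^ n) (\<lambda>x. c * f x) = (\<lambda>x. c * (kernel_op K ^^ n) f x)"
  by (induction n) (auto simp: kernel_op_cmult)

lemma funpow_kernel_op_sum:
  "(kernel_op K ^^ n) (\<lambda>x. \<Sum>i\<in>I. f i x) = (\<lambda>x. \<Sum>i\<in>I. (kernel_op K ^^ n) (f i) x)"
  by (induction n) (auto simp: kernel_op_sum)

text \<open>The source \<open>x\<close> comes before the target \<open>y\<close>, whereas adjacency
  matrices carry the target first.\<close>

definition step_prob :: "('s::finite \<Rightarrow> 's pmf) \<Rightarrow> nat \<Rightarrow> 's \<Rightarrow> 's \<Rightarrow> real" where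
  "step_prob K n x y = (kernel_op K ^^ n) (indicator {y}) x"

text \<open>Expand \<open>f\<close> in point indicators and use linearity. With an n-step
  probability in the place of \<open>f\<close> this becomes the Chapman-Kolmogorov equation
  \<open>step_prob_add_eq\<close>.\<close>

lemma funpow_kernel_op_eq_sum:
  "(kernel_op K ^^ n) f x = (\<Sum>y\<in>UNIV. step_prob K n x y * f y)"
proof -
  have "(kernel_op K ^^ n) (\<lambda>x. \<Sum>y\<in>UNIV. f y * indicator {y} x) x
      = (\<Sum>y\<in>UNIV. f y * (kernel_op K ^^ n) (indicator {y}) x)"
    by (simp only: funpow_kernel_op_sum funpow_kernel_op_cmult)
  also have "(\<lambda>x. \<Sum>y\<in>UNIV. f y * indicator {y} x) = f"
    by (auto simp: indicator_def)
  finally show ?thesis by (simp only: step_prob_def mult.commute)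
qed

lemma step_prob_nonneg: "0 \<le> step_prob K n x y"
  using funpow_kernel_op_mono[of "\<lambda>_. 0" "indicator {y}" n K x]
  by (simp add: funpow_kernel_op_const step_prob_def)

lemma step_prob_sum: "(\<Sum>y\<in>UNIV. step_prob K n x y) = 1"
  using funpow_kernel_op_eq_sum[of n K "\<lambda>_. 1" x, symmetric]
  by (simp only: funpow_kernel_op_const mult_1_right)

lemma step_prob_0: "step_prob K 0 x y = indicator {y} x"
  by (simp add: step_prob_def)

lemma step_prob_1: "step_prob K 1 x y = pmf (K x) y"
  by (simp add: step_prob_def kernel_op_def indicator_def)

lemma step_prob_add_eq: "step_prob K (m + n) x y = (\<Sum>z\<in>UNIV. step_prob K m x z * step_prob K n z y)"
  unfolding step_prob_def[of K "m + n"] funpow_add comp_def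
  by (subst funpow_kernel_op_eq_sum) (simp add: step_prob_def[of K n])

lemma step_prob_pos_add:
  assumes "0 < step_prob K m x z" "0 < step_prob K n z y"
  shows "0 < step_prob K (m + n) x y"
proof -
  have "0 < step_prob K m x z * step_prob K n z y" using assms by simp
  also have "\<dots> \<le> step_prob K (m + n) x y"
    unfolding step_prob_add_eq
    using member_le_sum[of z UNIV "\<lambda>z. step_prob K m x z * step_prob K n z y"]
    by (simp add: step_prob_nonneg)
  finally show ?thesis .
qed

lemma step_prob_uniformly_pos:
  assumes irr: "\<And>x y. \<exists>n. 0 < step_prob K n x y"
    and aper: "\<And>x. Gcd {n. 0 < step_prob K n x x} = 1"
  shows "\<exists>n. \<forall>x y. 0 < step_prob K n x y"
proof -
  have "\<exists>N. \<forall>n\<ge>N. n \<in> {n. 0 < step_prob K n x x}" for x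
    by (rule add_closed_Gcd_1_cofinite[OF _ _ aper]) (auto intro: step_prob_pos_add simp: step_prob_0)
  then obtain N where N: "\<And>x n. n \<ge> N x \<Longrightarrow> 0 < step_prob K n x x"
    unfolding mem_Collect_eq by metis
  define r where "r x y = (SOME n. 0 < step_prob K n x y)" for x y
  have r: "0 < step_prob K (r x y) x y" for x y
    unfolding r_def using irr by (rule someI_ex)
  \<comment> \<open>One exponent for all pairs: summing all loop thresholds and connecting times
    dominates every \<open>N x + r x y\<close>. The surplus \<open>c\<close> is spent on loops at
    \<open>x\<close>, which exist at every length from \<open>N x\<close> on.\<close>
  define n where "n = (\<Sum>x\<in>UNIV. N x + (\<Sum>y\<in>UNIV. r x y))"
  have "0 < step_prob K n x y" for x y
  proof -
    have "N x + r x y \<le> N x + (\<Sum>y\<in>UNIV. r x y)"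
      using member_le_sum[of y UNIV "r x"] by simp
    also have "\<dots> \<le> n" unfolding n_def
      using member_le_sum[of x UNIV "\<lambda>x. N x + (\<Sum>y\<in>UNIV. r x y)"] by simp
    finally obtain c where c: "n = N x + r x y + c" using le_Suc_ex by blast
    have "0 < step_prob K ((N x + c) + r x y) x y"
      by (rule step_prob_pos_add[OF N r]) simp
    then show ?thesis by (simp only: c ac_simps)
  qed
  then show ?thesis by blast
qed

text \<open>Doeblin contraction: if all \<open>p\<close>-step transition probabilities are at least \<open>\<delta>\<close>, then
  \<open>p\<close> steps shrink the oscillation of a function by the factor \<open>1 - \<delta>\<close>.\<close>

lemma funpow_kernel_op_convergent:
  fixes K :: "'s::finite \<Rightarrow> 's pmf"
  assumes pos: "\<And>x y. 0 < step_prob K p x y"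
  shows "\<exists>c. \<forall>x. (\<lambda>n. (kernel_op K ^^ n) f x) \<longlonglongrightarrow> c"
proof -
  define F where "F n = (kernel_op K ^^ n) f" for n
  define U where "U n = Max (range (F n))" for n
  define L where "L n = Min (range (F n))" for n
  have F_add: "F (m + n) = (kernel_op K ^^ m) (F n)" for m n
    by (simp add: F_def funpow_add)
  have FU: "F n x \<le> U n" and LF: "L n \<le> F n x" for n x
    by (auto simp: U_def L_def)
  have U_le: "U n \<le> c" if "\<And>x. F n x \<le> c" for n c
    using that by (auto simp: U_def)
  have L_ge: "c \<le> L n" if "\<And>x. c \<le> F n x" for n c
    using that by (auto simp: L_def)
  have U_anti: "U (m + n) \<le> U n" for m n
    using funpow_kernel_op_mono[of "F n" "\<lambda>_. U n" m K] FU
    by (intro U_le) (simp add: F_add funpow_kernel_op_const)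
  have L_mono: "L n \<le> L (m + n)" for m n
    using funpow_kernel_op_mono[of "\<lambda>_. L n" "F n" m K] LF
    by (intro L_ge) (simp add: F_add funpow_kernel_op_const)
  have LU: "L n \<le> U n" for n using FU LF order_trans by blast
  define \<delta> where "\<delta> = Min (range (\<lambda>(x, y). step_prob K p x y))"
  have \<delta>: "0 < \<delta>" "\<delta> \<le> step_prob K p x y" for x y
    unfolding \<delta>_def using pos by (auto intro!: Min_le)
  \<comment> \<open>\<open>undefined\<close> stands for an arbitrary state. The bound keeps the
    factor \<open>1 - \<delta>\<close> nonnegative, so that the contraction can be iterated.\<close>
  have "\<delta> \<le> 1"
    using \<delta>(2)[of undefined undefined] member_le_sum[of undefined UNIV "step_prob K p undefined"]
    by (simp add: step_prob_nonneg step_prob_sum)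
  have contract: "U (p + n) - L (p + n) \<le> (1 - \<delta>) * (U n - L n)" for n
  proof -
    \<comment> \<open>The mass of at least \<open>\<delta>\<close> that \<open>p\<close> steps put
      on a minimum point \<open>z\<close> of \<open>F n\<close> pulls the maximum down by
      \<open>\<delta>\<close> times the oscillation, while the minimum does not fall.\<close>
    have "L n \<in> range (F n)" unfolding L_def by (rule Min_in) auto
    then obtain z where z: "F n z = L n" by auto
    have "F (p + n) x \<le> U n - \<delta> * (U n - L n)" for x
    proof -
      have "F (p + n) x = (\<Sum>y\<in>UNIV. step_prob K p x y * F n y)"
        unfolding F_add by (rule funpow_kernel_op_eq_sum)
      also have "\<dots> = U n - (\<Sum>y\<in>UNIV. step_prob K p x y * (U n - F n y))"
        by (simp add: algebra_simps sum_subtractf sum_distrib_left[symmetric] step_prob_sum)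
      also have "\<dots> \<le> U n - step_prob K p x z * (U n - F n z)"
        using member_le_sum[of z UNIV "\<lambda>y. step_prob K p x y * (U n - F n y)"] FU
        by (simp add: step_prob_nonneg)
      also have "\<dots> \<le> U n - \<delta> * (U n - L n)"
        unfolding z using \<delta>(2)[of x z] LU[of n] by (simp add: mult_right_mono)
      finally show ?thesis .
    qed
    from U_le[OF this] L_mono[of n p] show ?thesis by (simp add: algebra_simps)
  qed
  \<comment> \<open>This controls only multiples of \<open>p\<close>; the monotonicity of
    \<open>U\<close> and \<open>L\<close> carries the bound over to the limits of the full
    sequences.\<close>
  have geom: "U (k * p) - L (k * p) \<le> (1 - \<delta>) ^ k * (U 0 - L 0)" for k
  proof (induction k)
    case (Suc k)
    have "U (Suc k * p) - L (Suc k * p) \<le> (1 - \<delta>) * (U (k * p) - L (k * p))"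
      using contract[of "k * p"] by simp
    also have "\<dots> \<le> (1 - \<delta>) * ((1 - \<delta>) ^ k * (U 0 - L 0))"
      using Suc \<open>\<delta> \<le> 1\<close> by (intro mult_left_mono) auto
    finally show ?case by simp
  qed simp
  have "decseq U" using U_anti[of 1] by (intro decseq_SucI) simp
  have "incseq L" using L_mono[of _ 1] by (intro incseq_SucI) simp
  have "L 0 \<le> U n" "L n \<le> U 0" for n
    using LU[of n] U_anti[of n 0] L_mono[of 0 n] by simp_all
  obtain u where u: "U \<longlonglongrightarrow> u" using decseq_convergent[OF \<open>decseq U\<close>] \<open>\<And>n. L 0 \<le> U n\<close> by blast
  obtain l where l: "L \<longlonglongrightarrow> l" using incseq_convergent[OF \<open>incseq L\<close>] \<open>\<And>n. L n \<le> U 0\<close> by blast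
  have "(\<lambda>k. (1 - \<delta>) ^ k * (U 0 - L 0)) \<longlonglongrightarrow> 0 * (U 0 - L 0)"
    using \<delta>(1) \<open>\<delta> \<le> 1\<close> by (intro tendsto_intros LIMSEQ_power_zero) auto
  moreover have "u - l \<le> (1 - \<delta>) ^ k * (U 0 - L 0)" for k
    using geom[of k] decseq_ge[OF \<open>decseq U\<close> u, of "k * p"] incseq_le[OF \<open>incseq L\<close> l, of "k * p"]
    by linarith
  ultimately have "u - l \<le> 0"
    using LIMSEQ_le_const[of _ "0 * (U 0 - L 0)" "u - l"] by auto
  moreover have "l \<le> u"
    using LIMSEQ_le[OF l u] LU by blast
  ultimately have "L \<longlonglongrightarrow> u" using l by simp
  then have "(\<lambda>n. F n x) \<longlonglongrightarrow> u" for x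
    by (intro tendsto_sandwich[of L "\<lambda>n. F n x" sequentially U u] u) (simp_all add: FU LF)
  then show ?thesis unfolding F_def by blast
qed

section \<open>The limit law and stationary laws\<close>

lemma finite_markov_convergence:
  fixes K :: "'s::finite \<Rightarrow> 's pmf"
  assumes "\<And>x y. \<exists>n. 0 < step_prob K n x y"
    and "\<And>x. Gcd {n. 0 < step_prob K n x x} = 1"
  obtains \<nu> :: "'s pmf" where "\<And>x y. (\<lambda>n. step_prob K n x y) \<longlonglongrightarrow> pmf \<nu> y"
proof -
  obtain p where "\<And>x y. 0 < step_prob K p x y"
    using step_prob_uniformly_pos[OF assms] by blast
  from funpow_kernel_op_convergent[OF this]
  have "\<exists>c. \<forall>x. (\<lambda>n. step_prob K n x y) \<longlonglongrightarrow> c" for y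
    unfolding step_prob_def .
  then obtain c where c: "\<And>x y. (\<lambda>n. step_prob K n x y) \<longlonglongrightarrow> c y" by metis
  have nonneg: "0 \<le> c y" for y
    by (rule LIMSEQ_le_const[OF c[of undefined y]]) (auto intro: step_prob_nonneg)
  \<comment> \<open>The sum over states is finite, so no mass is lost in the limit and the limits
    \<open>c\<close> form a law.\<close>
  have "(\<lambda>n. \<Sum>y\<in>UNIV. step_prob K n undefined y) \<longlonglongrightarrow> (\<Sum>y\<in>UNIV. c y)"
    by (intro tendsto_sum c)
  then have "(\<Sum>y\<in>UNIV. c y) = 1"
    by (simp add: step_prob_sum LIMSEQ_const_iff)
  then have "(\<integral>\<^sup>+ y. ennreal (c y) \<partial>count_space UNIV) = 1"
    by (simp add: nn_integral_count_space_finite sum_ennreal nonneg)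
  then have "pmf (embed_pmf c) y = c y" for y
    by (intro pmf_embed_pmf nonneg)
  with c that[of "embed_pmf c"] show ?thesis by simp
qed

text \<open>Started from a stationary law the chain keeps that law for all \<open>n\<close>, while
  convergence from every point forces the law at time \<open>n\<close> towards
  \<open>\<nu>\<close>.\<close>

lemma stationary_eq_limit:
  assumes lim: "\<And>x y. (\<lambda>n. step_prob K n x y) \<longlonglongrightarrow> pmf \<nu> y"
    and \<nu>': "bind_pmf \<nu>' K = \<nu>'"
  shows "\<nu>' = \<nu>"
proof (rule pmf_eqI)
  fix y
  have fixed: "(\<Sum>x\<in>UNIV. pmf \<nu>' x * pmf (K x) z) = pmf \<nu>' z" for z
    using arg_cong[OF \<nu>', of "\<lambda>p. pmf p z"]
    by (simp add: pmf_bind integral_measure_pmf_real[of UNIV] mult.commute)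
  have "(\<Sum>x\<in>UNIV. pmf \<nu>' x * step_prob K n x y) = pmf \<nu>' y" for n
  proof (induction n)
    case (Suc n)
    have "(\<Sum>x\<in>UNIV. pmf \<nu>' x * step_prob K (Suc n) x y)
        = (\<Sum>z\<in>UNIV. (\<Sum>x\<in>UNIV. pmf \<nu>' x * pmf (K x) z) * step_prob K n z y)"
      unfolding step_prob_add_eq[of K 1 n, simplified plus_1_eq_Suc] step_prob_1
        sum_distrib_left sum_distrib_right
      by (subst sum.swap) (simp add: mult_ac)
    also have "\<dots> = pmf \<nu>' y" unfolding fixed by (rule Suc)
    finally show ?case .
  qed (simp add: step_prob_0 indicator_def)
  moreover have "(\<lambda>n. \<Sum>x\<in>UNIV. pmf \<nu>' x * step_prob K n x y) \<longlonglongrightarrow> (\<Sum>x\<in>UNIV. pmf \<nu>' x * pmf \<nu> y)"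
    by (intro tendsto_intros lim)
  ultimately show "pmf \<nu>' y = pmf \<nu> y"
    by (simp add: sum_distrib_right[symmetric] sum_pmf_eq_1 LIMSEQ_const_iff)
qed

text \<open>Split off the last of \<open>n + 1\<close> steps and let \<open>n\<close> tend to
  infinity; the starting point, here \<open>undefined\<close>, is arbitrary.\<close>

lemma limit_is_stationary:
  assumes lim: "\<And>x y. (\<lambda>n. step_prob K n x y) \<longlonglongrightarrow> pmf \<nu> y"
  shows "bind_pmf \<nu> K = \<nu>"
proof (rule pmf_eqI)
  fix y
  have "(\<lambda>n. step_prob K (n + 1) undefined y) \<longlonglongrightarrow> pmf \<nu> y"
    by (rule LIMSEQ_ignore_initial_segment[OF lim])
  moreover have "step_prob K (n + 1) x y = (\<Sum>z\<in>UNIV. step_prob K n x z * pmf (K z) y)" for n x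
    unfolding step_prob_add_eq step_prob_1 ..
  moreover have "(\<lambda>n. \<Sum>z\<in>UNIV. step_prob K n undefined z * pmf (K z) y)
      \<longlonglongrightarrow> (\<Sum>z\<in>UNIV. pmf \<nu> z * pmf (K z) y)"
    by (intro tendsto_intros lim)
  ultimately have "(\<Sum>z\<in>UNIV. pmf \<nu> z * pmf (K z) y) = pmf \<nu> y"
    using LIMSEQ_unique by simp
  then show "pmf (bind_pmf \<nu> K) y = pmf \<nu> y"
    by (simp add: pmf_bind integral_measure_pmf_real[of UNIV] mult.commute)
qed

section \<open>Path cylinders\<close>

definition cyl :: "'a set \<Rightarrow> ('i \<Rightarrow> 'a \<Rightarrow> 's) \<Rightarrow> 'i set \<Rightarrow> ('i \<Rightarrow> 's) \<Rightarrow> 'a set" where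
  "cyl \<Omega> Z W z = {\<omega> \<in> \<Omega>. \<forall>i\<in>W. Z i \<omega> = z i}"

text \<open>For nested windows the cylinder over the larger one absorbs the other, unless the
  prescribed values clash; the empty set is adjoined for that case.\<close>

lemma Int_stable_cyl:
  fixes W :: "nat \<Rightarrow> 'i set"
  assumes "incseq W"
  shows "Int_stable (insert {} {cyl \<Omega> Z (W n) z | n z. True})"
proof -
  have *: "cyl \<Omega> Z (W n) z \<inter> cyl \<Omega> Z (W m) y \<in> insert {} {cyl \<Omega> Z (W n) z | n z. True}"
    if "n \<le> m" for n m z y
  proof -
    have "W n \<subseteq> W m" using assms that by (rule incseqD)
    then have "cyl \<Omega> Z (W n) z \<inter> cyl \<Omega> Z (W m) y =
        (if \<forall>i\<in>W n. y i = z i then cyl \<Omega> Z (W m) y else {})"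
      by (auto simp: cyl_def subset_iff) 
    then show ?thesis by auto
  qed
  have "cyl \<Omega> Z (W n) z \<inter> cyl \<Omega> Z (W m) y \<in> insert {} {cyl \<Omega> Z (W n) z | n z. True}" for n m z y
    using *[of n m z y] *[of m n y z] by (cases "n \<le> m") (auto simp: Int_commute)
  then show ?thesis unfolding Int_stable_def by blast
qed

lemma vimage_in_sigma_cyl:
  fixes Z :: "'i \<Rightarrow> 'a \<Rightarrow> 's::finite"
  assumes "finite (W n)" "i \<in> W n"
  shows "Z i -` A \<inter> \<Omega> \<in> sigma_sets \<Omega> (insert {} {cyl \<Omega> Z (W n) z | n z. True})"
    (is "_ \<in> sigma_sets \<Omega> ?G")
proof -
  interpret sigma_algebra \<Omega> "sigma_sets \<Omega> ?G"
    by (rule sigma_algebra_sigma_sets) (auto simp: cyl_def)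
  \<comment> \<open>Patterns are taken extensional, one function for each assignment on
    \<open>W n\<close>, which makes the union below finite.\<close>
  let ?I = "{z \<in> PiE (W n) (\<lambda>_. UNIV). z i \<in> A}"
  have "Z i -` A \<inter> \<Omega> = (\<Union>z\<in>?I. cyl \<Omega> Z (W n) z)"
  proof (intro equalityI subsetI)
    fix \<omega> assume "\<omega> \<in> Z i -` A \<inter> \<Omega>"
    then show "\<omega> \<in> (\<Union>z\<in>?I. cyl \<Omega> Z (W n) z)"
      using assms by (intro UN_I[of "restrict (\<lambda>i. Z i \<omega>) (W n)"]) (auto simp: cyl_def)
  next
    fix \<omega> assume "\<omega> \<in> (\<Union>z\<in>?I. cyl \<Omega> Z (W n) z)"
    then obtain z where "z i \<in> A" "\<omega> \<in> cyl \<Omega> Z (W n) z" by blast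
    with assms(2) show "\<omega> \<in> Z i -` A \<inter> \<Omega>" by (auto simp: cyl_def)
  qed
  moreover have "finite ?I"
    using finite_PiE[OF assms(1), of "\<lambda>_. UNIV :: 's set"] by simp
  moreover have "cyl \<Omega> Z (W n) z \<in> sigma_sets \<Omega> ?G" for z
    by (rule sigma_sets.Basic) blast
  ultimately show ?thesis by (simp only: finite_UN)
qed

lemma sigma_cyl:
  fixes Z :: "'i \<Rightarrow> 'a \<Rightarrow> 's::finite"
  assumes "\<And>n. finite (W n)" "(\<Union>n. W n) = I"
  shows "sigma_sets \<Omega> (\<Union>i\<in>I. {Z i -` A \<inter> \<Omega> | A. A \<in> UNIV})
       = sigma_sets \<Omega> (insert {} {cyl \<Omega> Z (W n) z | n z. True})" (is "sigma_sets \<Omega> ?F = sigma_sets \<Omega> ?G")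
proof (intro equalityI sigma_sets_mono)
  show "?F \<subseteq> sigma_sets \<Omega> ?G"
  proof (intro UN_least subsetI)
    fix i B assume "i \<in> I" and B: "B \<in> {Z i -` A \<inter> \<Omega> | A. A \<in> UNIV}"
    then obtain n where "i \<in> W n" using assms(2) by blast
    from vimage_in_sigma_cyl[of W, OF assms(1) this] B show "B \<in> sigma_sets \<Omega> ?G" by auto
  qed
  have "cyl \<Omega> Z (W n) z \<in> sigma_sets \<Omega> ?F" for n z
  proof -
    have "{\<omega>\<in>\<Omega>. Z i \<omega> = z i} \<in> sigma_sets \<Omega> ?F" if "i \<in> W n" for i
    proof -
      have "i \<in> I" using that assms(2) by blast
      moreover have "{\<omega>\<in>\<Omega>. Z i \<omega> = z i} = Z i -` {z i} \<inter> \<Omega>" by auto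
      ultimately have "{\<omega>\<in>\<Omega>. Z i \<omega> = z i} \<in> ?F"
        by (intro UN_I[of i] CollectI exI[of _ "{z i}"]) auto
      then show ?thesis by (rule sigma_sets.Basic)
    qed
    note Z = this
    interpret sigma_algebra \<Omega> "sigma_sets \<Omega> ?F"
      by (rule sigma_algebra_sigma_sets) auto
    from sets_Collect_finite_All[where S = "W n" and P = "\<lambda>i \<omega>. Z i \<omega> = z i", OF Z assms(1)]
    show ?thesis unfolding cyl_def .
  qed
  then show "?G \<subseteq> sigma_sets \<Omega> ?F" by (auto intro: sigma_sets.Empty)
qed

lemma sets_PiM_count_space_eq:
  "sets (Pi\<^sub>M I (\<lambda>_. count_space UNIV)) =
   sigma_sets (PiE I (\<lambda>_. UNIV)) (\<Union>i\<in>I. {(\<lambda>f. f i) -` A \<inter> PiE I (\<lambda>_. UNIV) | A. A \<in> UNIV})"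
proof -
  have *: "(\<lambda>f. f i) -` A \<inter> PiE I (\<lambda>_. UNIV) = {f \<in> PiE I (\<lambda>_. UNIV). f i \<in> A}" for i and A :: "'b set"
    by blast
  have "(\<Union>i\<in>I. {(\<lambda>f. f i) -` A \<inter> PiE I (\<lambda>_. UNIV) | A :: 'b set. A \<in> UNIV})
      = {{f \<in> PiE I (\<lambda>_. UNIV). f i \<in> A} | i A. i \<in> I \<and> A \<in> UNIV}"
    unfolding * by blast
  then show ?thesis unfolding sets_PiM_single by simp
qed

text \<open>The empty window \<open>W 0\<close> makes the whole space a cylinder. Hence a constant
  sequence from the generator exhausts the space, and the case \<open>n = 0\<close> of
  \<open>eq\<close> compares total masses.\<close>

lemma measure_eqI_cyl:
  fixes P Q :: "('i \<Rightarrow> 's::finite) measure"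
  assumes P: "sets P = sets (Pi\<^sub>M UNIV (\<lambda>_. count_space UNIV))"
    and Q: "sets Q = sets (Pi\<^sub>M UNIV (\<lambda>_. count_space UNIV))"
    and fin: "finite_measure P"
    and W: "incseq W" "\<And>n. finite (W n)" "(\<Union>n. W n) = UNIV" "W 0 = {}"
    and eq: "\<And>n z. emeasure P {f. \<forall>i\<in>W n. f i = z i} = emeasure Q {f. \<forall>i\<in>W n. f i = z i}"
  shows "P = Q"
proof (rule measure_eqI_generator_eq)
  let ?G = "insert {} {cyl UNIV (\<lambda>i f. f i) (W n) z | n z. True} :: ('i \<Rightarrow> 's) set set"
  show "Int_stable ?G" by (rule Int_stable_cyl) fact
  show "?G \<subseteq> Pow UNIV" by auto
  show "emeasure P X = emeasure Q X" if "X \<in> ?G" for X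
    using that by (auto simp: cyl_def eq)
  show "sets P = sigma_sets UNIV ?G" "sets Q = sigma_sets UNIV ?G"
    unfolding P Q sets_PiM_count_space_eq using sigma_cyl[OF W(2,3), of "UNIV" "\<lambda>i f. f i"] by simp_all
  have "cyl UNIV (\<lambda>i f. f i) (W 0) undefined = (UNIV :: ('i \<Rightarrow> 's) set)"
    by (simp add: cyl_def W(4))
  then show "range (\<lambda>_::nat. UNIV) \<subseteq> ?G" by blast
  interpret finite_measure P by fact
  show "emeasure P UNIV \<noteq> \<infinity>" by simp
qed auto

section \<open>Two-sided stationary chains\<close>

text \<open>Paths are \<open>undefined\<close> outside the window \<open>{m..m + n}\<close>; this is what makes
  \<open>chain_pmf_restrict_left\<close> an equation between laws on the same function type.\<close>

primrec chain_pmf :: "'s pmf \<Rightarrow> ('s \<Rightarrow> 's pmf) \<Rightarrow> int \<Rightarrow> nat \<Rightarrow> (int \<Rightarrow> 's) pmf" where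
  "chain_pmf \<pi> Q m 0 = map_pmf (\<lambda>z. (\<lambda>_. undefined)(m := z)) \<pi>"
| "chain_pmf \<pi> Q m (Suc n) = bind_pmf (chain_pmf \<pi> Q m n)
     (\<lambda>f. map_pmf (\<lambda>z. f(m + int (Suc n) := z)) (Q (f (m + int n))))"

lemma emeasure_chain_pmf:
  "emeasure (chain_pmf \<pi> Q m n) {f. \<forall>i\<le>n. f (m + int i) = z i}
     = ennreal (pmf \<pi> (z 0) * (\<Prod>i<n. pmf (Q (z i)) (z (Suc i))))"
proof (induction n)
  case 0
  have "(\<lambda>w. (\<lambda>_. undefined)(m := w)) -` {f. f m = z 0} = {z 0}" by auto
  then show ?case by (simp add: emeasure_pmf_single)
next
  case (Suc n)
  let ?A = "\<lambda>n. {f. \<forall>i\<le>n. f (m + int i) = z i}"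
  let ?k = "m + int (Suc n)"
  have "emeasure (map_pmf (\<lambda>w. f(?k := w)) (Q (f (m + int n)))) (?A (Suc n))
      = ennreal (pmf (Q (z n)) (z (Suc n))) * indicator (?A n) f" for f
  proof -
    \<comment> \<open>Writing time \<open>?k\<close> leaves the earlier coordinates alone, so the
      constraints split into one on \<open>f\<close> and one on the new value.\<close>
    have "(\<lambda>w. f(?k := w)) -` ?A (Suc n) = (if f \<in> ?A n then {z (Suc n)} else {})"
      by (auto simp: le_Suc_eq)
    then show ?thesis by (auto simp: emeasure_pmf_single)
  qed
  then have "emeasure (chain_pmf \<pi> Q m (Suc n)) (?A (Suc n))
      = (\<integral>\<^sup>+f. ennreal (pmf (Q (z n)) (z (Suc n))) * indicator (?A n) f \<partial>chain_pmf \<pi> Q m n)"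
    unfolding chain_pmf.simps emeasure_bind_pmf by simp
  also have "\<dots> = ennreal (pmf (Q (z n)) (z (Suc n))) * emeasure (chain_pmf \<pi> Q m n) (?A n)"
    by (rule nn_integral_cmult_indicator) simp
  finally show ?case
    unfolding Suc by (simp add: ennreal_mult'[symmetric] mult_ac prod_nonneg)
qed

lemma restrict_upd_notin: "k \<notin> J \<Longrightarrow> restrict (f(k := z)) J = restrict f J"
  by (auto simp: restrict_def)

lemma chain_pmf_restrict_right:
  assumes "J \<subseteq> {..m + int n}"
  shows "map_pmf (\<lambda>f. restrict f J) (chain_pmf \<pi> Q m (n + r)) = map_pmf (\<lambda>f. restrict f J) (chain_pmf \<pi> Q m n)"
proof (induction r)
  case (Suc r)
  have k: "m + int (Suc (n + r)) \<notin> J" using assms by auto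
  have "map_pmf (\<lambda>f. restrict f J) (chain_pmf \<pi> Q m (n + Suc r))
      = bind_pmf (chain_pmf \<pi> Q m (n + r)) (\<lambda>f. return_pmf (restrict f J))"
    by (simp only: add_Suc_right chain_pmf.simps map_bind_pmf map_pmf_comp restrict_upd_notin[OF k] map_pmf_const)
  with Suc show ?case by (simp only: map_pmf_def)
qed simp

text \<open>After the first state is forgotten, stationarity gives the second one the law
  \<open>\<pi>\<close> again, and later steps read only coordinates that survive. The restriction
  resets coordinate \<open>m\<close> to \<open>undefined\<close>, as in a path that starts at
  \<open>m + 1\<close>.\<close>

lemma chain_pmf_restrict_left:
  assumes stat: "bind_pmf \<pi> Q = \<pi>"
  shows "map_pmf (\<lambda>f. restrict f {m + 1..}) (chain_pmf \<pi> Q m (Suc n)) = chain_pmf \<pi> Q (m + 1) n"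
proof (induction n)
  case 0
  have "restrict ((\<lambda>_. undefined)(m := z, m + 1 := z')) {m + 1..} = (\<lambda>_. undefined)(m + 1 := z')" for z z' :: 'a
    by (auto simp: restrict_def)
  then have "map_pmf (\<lambda>f. restrict f {m + 1..}) (chain_pmf \<pi> Q m (Suc 0))
      = bind_pmf \<pi> (\<lambda>z. map_pmf (\<lambda>z'. (\<lambda>_. undefined)(m + 1 := z')) (Q z))"
    by (simp add: bind_map_pmf map_bind_pmf map_pmf_comp)
  also have "\<dots> = map_pmf (\<lambda>z'. (\<lambda>_. undefined)(m + 1 := z')) (bind_pmf \<pi> Q)"
    by (simp add: map_bind_pmf)
  finally show ?case by (simp only: stat chain_pmf.simps)
next
  case (Suc n)
  let ?r = "\<lambda>f. restrict f {m + 1..}"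
  have k: "m + int (Suc (Suc n)) = m + 1 + int (Suc n)" "m + int (Suc n) = m + 1 + int n" by auto
  have upd: "?r (f(m + 1 + int (Suc n) := z)) = (?r f)(m + 1 + int (Suc n) := z)" for f :: "int \<Rightarrow> 'a" and z
    by (auto simp: restrict_def)
  have r_app: "?r f (m + 1 + int n) = f (m + 1 + int n)" for f :: "int \<Rightarrow> 'a" by simp
  have "map_pmf ?r (chain_pmf \<pi> Q m (Suc (Suc n)))
      = bind_pmf (chain_pmf \<pi> Q m (Suc n))
          (\<lambda>f. map_pmf (\<lambda>z. (?r f)(m + 1 + int (Suc n) := z)) (Q (?r f (m + 1 + int n))))"
    by (simp only: chain_pmf.simps(2)[of \<pi> Q m "Suc n"] map_bind_pmf map_pmf_comp k upd r_app)
  also have "\<dots> = bind_pmf (map_pmf ?r (chain_pmf \<pi> Q m (Suc n)))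
          (\<lambda>f. map_pmf (\<lambda>z. f(m + 1 + int (Suc n) := z)) (Q (f (m + 1 + int n))))"
    by (simp only: bind_map_pmf)
  finally show ?case by (simp only: Suc chain_pmf.simps(2)[of \<pi> Q "m + 1" n])
qed

lemma chain_pmf_restrict_window:
  assumes stat: "bind_pmf \<pi> Q = \<pi>" and J: "J \<subseteq> {m..m + int n}"
  shows "map_pmf (\<lambda>f. restrict f J) (chain_pmf \<pi> Q (m - int l) (n + l + r))
       = map_pmf (\<lambda>f. restrict f J) (chain_pmf \<pi> Q m n)"
proof (induction l)
  case 0
  have "J \<subseteq> {..m + int n}" using J by auto
  then show ?case by (simp add: chain_pmf_restrict_right del: restrict_apply)
next
  case (Suc l)
  let ?m = "m - int (Suc l)"
  have "J \<subseteq> {?m + 1..}" using J by auto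
  then have "restrict (restrict f {?m + 1..}) J = restrict f J" for f :: "int \<Rightarrow> 'a"
    by (simp only: restrict_restrict Int_absorb1)
  then have "map_pmf (\<lambda>f. restrict f J) (chain_pmf \<pi> Q ?m (Suc (n + l + r)))
      = map_pmf (\<lambda>f. restrict f J) (map_pmf (\<lambda>f. restrict f {?m + 1..}) (chain_pmf \<pi> Q ?m (Suc (n + l + r))))"
    by (simp only: map_pmf_comp)
  also have "\<dots> = map_pmf (\<lambda>f. restrict f J) (chain_pmf \<pi> Q (m - int l) (n + l + r))"
    unfolding chain_pmf_restrict_left[OF stat] by simp
  finally show ?case by (simp only: Suc add_Suc_right add_Suc)
qed

section \<open>Kolmogorov extension of the window laws\<close>

text \<open>The extension theorem is applied on Polish spaces. The wrapper \<open>discrete\<close>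
  supplies the discrete topology, under which a countable state space is Polish and every subset is
  Borel.\<close>

definition chain_marginal ::
  "'s pmf \<Rightarrow> ('s \<Rightarrow> 's pmf) \<Rightarrow> int set \<Rightarrow> int \<Rightarrow> nat \<Rightarrow> (int \<Rightarrow> 's discrete) measure" where
  "chain_marginal \<pi> Q J m n =
     distr (chain_pmf \<pi> Q m n) (Pi\<^sub>M J (\<lambda>_. borel)) (\<lambda>f. \<lambda>i\<in>J. discrete (f i))"

lemma chain_marginal_restrict:
  "chain_marginal \<pi> Q J m n =
     distr (map_pmf (\<lambda>f. restrict f J) (chain_pmf \<pi> Q m n)) (Pi\<^sub>M J (\<lambda>_. borel)) (\<lambda>f. \<lambda>i\<in>J. discrete (f i))"
proof -
  have "(\<lambda>f. \<lambda>i\<in>J. discrete (f i)) \<in> measurable (count_space UNIV) (Pi\<^sub>M J (\<lambda>_. borel))"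
    by (auto simp: measurable_def space_PiM)
  then show ?thesis
    unfolding chain_marginal_def map_pmf_rep_eq
    by (subst distr_distr) (auto simp: comp_def intro!: distr_cong)
qed

lemma chain_marginal_window:
  assumes "bind_pmf \<pi> Q = \<pi>" "J \<subseteq> {m..m + int n}"
  shows "chain_marginal \<pi> Q J (m - int l) (n + l + r) = chain_marginal \<pi> Q J m n"
  unfolding chain_marginal_restrict chain_pmf_restrict_window[OF assms] ..

text \<open>Both windows are extended to their common hull \<open>{a..b}\<close>, where the two
  marginals come from the same path law.\<close>

lemma chain_marginal_eq:
  assumes stat: "bind_pmf \<pi> Q = \<pi>" and J: "J \<subseteq> {m..m + int n}" "J \<subseteq> {m'..m' + int n'}"
  shows "chain_marginal \<pi> Q J m n = chain_marginal \<pi> Q J m' n'"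
proof -
  define a where "a = min m m'"
  define b where "b = max (m + int n) (m' + int n')"
  have *: "n + nat (m - a) + nat (b - (m + int n)) = nat (b - a)"
    "n' + nat (m' - a) + nat (b - (m' + int n')) = nat (b - a)"
    by (auto simp: a_def b_def)
  have "chain_marginal \<pi> Q J m n = chain_marginal \<pi> Q J a (nat (b - a))"
    using chain_marginal_window[OF stat J(1), of "nat (m - a)" "nat (b - (m + int n))"] *(1)
    by (simp add: a_def)
  moreover have "chain_marginal \<pi> Q J m' n' = chain_marginal \<pi> Q J a (nat (b - a))"
    using chain_marginal_window[OF stat J(2), of "nat (m' - a)" "nat (b - (m' + int n'))"] *(2)
    by (simp add: a_def)
  ultimately show ?thesis by simp
qed

lemma finite_subset_window:
  assumes "finite J" shows "\<exists>n. J \<subseteq> {- int n..- int n + int (2 * n)}"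
proof -
  have "\<exists>n. \<forall>j\<in>J. \<bar>j\<bar> \<le> int n"
    using assms
  proof (induction J)
    case (insert j J)
    then obtain n where "\<forall>j\<in>J. \<bar>j\<bar> \<le> int n" by blast
    then have "\<forall>i\<in>insert j J. \<bar>i\<bar> \<le> int (n + nat \<bar>j\<bar>)" by force
    then show ?case by blast
  qed simp
  then obtain n where "\<forall>j\<in>J. \<bar>j\<bar> \<le> int n" by blast
  then show ?thesis by (intro exI[of _ n]) force
qed

lemma stationary_chain_exists:
  fixes \<pi> :: "'s::countable pmf"
  assumes stat: "bind_pmf \<pi> Q = \<pi>"
  obtains M :: "(int \<Rightarrow> 's) measure" where "prob_space M"
    "sets M = sets (Pi\<^sub>M UNIV (\<lambda>_. count_space UNIV))"
    "\<And>m n z. measure M {f. \<forall>i\<le>n. f (m + int i) = z i} = pmf \<pi> (z 0) * (\<Prod>i<n. pmf (Q (z i)) (z (Suc i)))"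
proof -
  \<comment> \<open>The half-width of some symmetric window around a finite \<open>J\<close>; by
    \<open>P_window\<close> below, the choice of the window does not affect the marginal.\<close>
  define N :: "int set \<Rightarrow> nat" where "N J = (SOME n. J \<subseteq> {- int n..- int n + int (2 * n)})" for J
  have N: "J \<subseteq> {- int (N J)..- int (N J) + int (2 * N J)}" if "finite J" for J
    unfolding N_def using finite_subset_window[OF that] by (rule someI_ex)
  define P :: "int set \<Rightarrow> (int \<Rightarrow> 's discrete) measure"
    where "P J = chain_marginal \<pi> Q J (- int (N J)) (2 * N J)" for J
  have P_window: "P J = chain_marginal \<pi> Q J m n" if "J \<subseteq> {m..m + int n}" for J m n
    unfolding P_def using that by (intro chain_marginal_eq[OF stat N] finite_subset[OF that]) auto
  have meas: "(\<lambda>f. \<lambda>i\<in>J. discrete (f i)) \<in> measurable (measure_pmf p) (Pi\<^sub>M J (\<lambda>_. borel))"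
    for J and p :: "(int \<Rightarrow> 's) pmf"
    by (auto simp: measurable_def space_PiM)
  interpret polish_projective UNIV P
  proof (intro polish_projective.intro projective_family.intro)
    fix J H :: "int set" assume JH: "J \<subseteq> H" "finite H"
    \<comment> \<open>The window chosen for \<open>H\<close> also contains \<open>J\<close>, so both
      marginals can be read from one path law.\<close>
    have "J \<subseteq> {- int (N H)..- int (N H) + int (2 * N H)}" using JH N[of H] by blast
    then have "P J = chain_marginal \<pi> Q J (- int (N H)) (2 * N H)" by (rule P_window)
    also have "\<dots> = distr (P H) (Pi\<^sub>M J (\<lambda>_. borel)) (\<lambda>f. restrict f J)"
      unfolding P_def chain_marginal_def
      using JH(1) by (subst distr_distr[OF measurable_restrict_subset meas])
        (auto simp: comp_def restrict_def subset_iff fun_eq_iff intro!: distr_cong)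
    finally show "P J = distr (P H) (Pi\<^sub>M J (\<lambda>_. borel)) (\<lambda>f. restrict f J)" .
  next
    fix J :: "int set"
    show "prob_space (P J)"
      unfolding P_def chain_marginal_def by (intro measure_pmf.prob_space_distr meas)
  qed
  define M where "M = distr lim (Pi\<^sub>M UNIV (\<lambda>_. count_space UNIV)) (\<lambda>f i. of_discrete (f i))"
  have of_discrete: "of_discrete \<in> measurable borel (count_space (UNIV :: 's set))"
    by (rule measurableI) (auto intro!: borel_open open_discrete)
  have meas_lim: "(\<lambda>f i. of_discrete (f i)) \<in> measurable lim (Pi\<^sub>M UNIV (\<lambda>_. count_space (UNIV :: 's set)))"
  proof (rule measurable_PiM_single')
    show "(\<lambda>f. of_discrete (f i)) \<in> measurable lim (count_space (UNIV :: 's set))" for i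
    proof (rule measurable_compose[OF _ of_discrete])
      show "(\<lambda>f. f i) \<in> borel_measurable lim"
        unfolding measurable_cong_sets[OF sets_lim refl] by simp
    qed
  qed auto
  show thesis
  proof (rule that[of M])
    show "prob_space M" unfolding M_def by (rule P.prob_space_distr[OF meas_lim])
    show "sets M = sets (Pi\<^sub>M UNIV (\<lambda>_. count_space UNIV))" by (simp add: M_def)
  next
    fix m n and z :: "nat \<Rightarrow> 's"
    let ?A = "{f. \<forall>i\<le>n. f (m + int i) = z i}"
    let ?J = "{m..m + int n}"
    define X where "X = (\<Pi>\<^sub>E j\<in>?J. {discrete (z (nat (j - m)))})"
    have X: "X \<in> sets (Pi\<^sub>M ?J (\<lambda>_. borel))"
      unfolding X_def by (rule sets_PiM_I_finite) auto
    \<comment> \<open>Translates between absolute times \<open>j\<close> in the window and offsets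
      \<open>i = j - m\<close> from its left end.\<close>
    have window: "(\<forall>j\<in>?J. R j (nat (j - m))) \<longleftrightarrow> (\<forall>i\<le>n. R (m + int i) i)" for R
    proof safe
      fix i assume "\<forall>j\<in>?J. R j (nat (j - m))" "i \<le> n"
      then show "R (m + int i) i" by (auto dest: bspec[of _ _ "m + int i"])
    next
      fix j assume "\<forall>i\<le>n. R (m + int i) i" "j \<in> ?J"
      then show "R j (nat (j - m))" by (auto dest!: spec[of _ "nat (j - m)"])
    qed
    have A: "?A \<in> sets (Pi\<^sub>M UNIV (\<lambda>_. count_space UNIV))"
    proof -
      have "{f \<in> space (Pi\<^sub>M UNIV (\<lambda>_. count_space UNIV)). \<forall>i\<in>{..n}. f (m + int i) = z i}
          \<in> sets (Pi\<^sub>M UNIV (\<lambda>_. count_space UNIV))"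
        by measurable
      then show ?thesis by (simp add: space_PiM Ball_def)
    qed
    have of_discrete_eq: "of_discrete w = s \<longleftrightarrow> w = discrete s" for w and s :: 's
      by (metis UNIV_I discrete_inverse of_discrete_inverse)
    have emb: "g \<in> prod_emb UNIV (\<lambda>_. borel) ?J X \<longleftrightarrow> (\<forall>j\<in>?J. g j = discrete (z (nat (j - m))))"
      for g :: "int \<Rightarrow> 's discrete"
      unfolding X_def prod_emb_def by (auto simp: space_PiM PiE_iff)
    have "(\<lambda>f i. of_discrete (f i)) -` ?A = prod_emb UNIV (\<lambda>_. borel) ?J X"
    proof (intro set_eqI)
      fix g :: "int \<Rightarrow> 's discrete"
      show "g \<in> (\<lambda>f i. of_discrete (f i)) -` ?A \<longleftrightarrow> g \<in> prod_emb UNIV (\<lambda>_. borel) ?J X"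
        unfolding emb window[of "\<lambda>j i. g j = discrete (z i)"]
        by (simp only: vimage_eq mem_Collect_eq of_discrete_eq)
    qed
    then have "measure M ?A = measure lim (prod_emb UNIV (\<lambda>_. borel) ?J X)"
      unfolding M_def using A by (subst measure_distr[OF meas_lim]) (auto simp: space_PiM)
    also have "\<dots> = measure (chain_marginal \<pi> Q ?J m n) X"
      using X P_window[of ?J m n] by (subst measure_lim_emb) auto
    also have "\<dots> = measure (chain_pmf \<pi> Q m n) ((\<lambda>f. \<lambda>i\<in>?J. discrete (f i)) -` X)"
      unfolding chain_marginal_def by (subst measure_distr[OF meas X]) simp
    also have "(\<lambda>f. \<lambda>i\<in>?J. discrete (f i)) -` X = ?A"
    proof (intro set_eqI)
      fix f :: "int \<Rightarrow> 's"
      have "f \<in> (\<lambda>f. \<lambda>i\<in>?J. discrete (f i)) -` X \<longleftrightarrow> (\<forall>j\<in>?J. f j = z (nat (j - m)))"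
        unfolding X_def by (auto simp: PiE_iff discrete_inject)
      then show "f \<in> (\<lambda>f. \<lambda>i\<in>?J. discrete (f i)) -` X \<longleftrightarrow> f \<in> ?A"
        unfolding window[of "\<lambda>j i. f j = z i"] by simp
    qed
    finally show "measure M ?A = pmf \<pi> (z 0) * (\<Prod>i<n. pmf (Q (z i)) (z (Suc i)))"
      unfolding measure_def emeasure_chain_pmf by (simp add: prod_nonneg)
  qed
qed

section \<open>Random walks and tail events\<close>

text \<open>The one-step kernel of the pair \<open>(X k, N k)\<close> given
  \<open>X (k - 1) = x\<close>. The map is kept in the state because the joint law and the tail
  field involve the maps as well.\<close>

definition move_law :: "('v \<Rightarrow> 'v) pmf \<Rightarrow> 'v \<Rightarrow> ('v \<times> ('v \<Rightarrow> 'v)) pmf" where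
  "move_law \<mu> x = map_pmf (\<lambda>\<sigma>. (\<sigma> x, \<sigma>)) \<mu>"

definition position_law :: "('v \<Rightarrow> 'v) pmf \<Rightarrow> 'v \<Rightarrow> 'v pmf" where
  "position_law \<mu> x = map_pmf (\<lambda>\<sigma>. \<sigma> x) \<mu>"

lemma pmf_move_law: "pmf (move_law \<mu> x) (y, \<sigma>) = (if \<sigma> x = y then pmf \<mu> \<sigma> else 0)"
proof -
  have "(\<lambda>\<sigma>. (\<sigma> x, \<sigma>)) -` {(y, \<sigma>)} = (if \<sigma> x = y then {\<sigma>} else {})" by auto
  then show ?thesis by (simp add: move_law_def pmf_map measure_pmf_single)
qed

lemma map_fst_move_law: "map_pmf fst (move_law \<mu> x) = position_law \<mu> x"
  by (simp add: move_law_def position_law_def map_pmf_comp)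

lemma map_snd_move_law: "map_pmf snd (move_law \<mu> x) = \<mu>"
  by (simp add: move_law_def map_pmf_comp)

lemma pmf_map_fst_eq_sum:
  fixes p :: "('a \<times> 'b::finite) pmf"
  shows "pmf (map_pmf fst p) x = (\<Sum>s\<in>UNIV. pmf p (x, s))"
proof -
  have "fst -` {x} = Pair x ` (UNIV :: 'b set)" by auto
  then show ?thesis
    by (simp add: pmf_map measure_measure_pmf_finite sum.reindex inj_on_def)
qed

text \<open>Merging the generators into those of one finite-valued process makes the cylinder lemmas
  applicable.\<close>

lemma past_eq_sigma_pairs:
  fixes X :: "int \<Rightarrow> 'a \<Rightarrow> 'v::finite" and N :: "int \<Rightarrow> 'a \<Rightarrow> 'v \<Rightarrow> 'v"
  shows "past M X N k = sigma_sets (space M)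
    (\<Union>j\<in>{..k}. {(\<lambda>\<omega>. (X j \<omega>, N j \<omega>)) -` A \<inter> space M | A. A \<in> UNIV})"
    (is "_ = sigma_sets ?\<Omega> ?G")
  unfolding past_def
proof (intro equalityI sigma_sets_mono)
  show "(\<Union>j\<in>{..k}. {X j -` B \<inter> ?\<Omega> | B. B \<in> UNIV} \<union> {N j -` C \<inter> ?\<Omega> | C. C \<in> UNIV}) \<subseteq> sigma_sets ?\<Omega> ?G"
  proof (intro UN_least Un_least subsetI)
    fix j S assume j: "j \<in> {..k}"
    have pair: "(\<lambda>\<omega>. (X j \<omega>, N j \<omega>)) -` A \<inter> ?\<Omega> \<in> sigma_sets ?\<Omega> ?G" for A
      using j by (intro sigma_sets.Basic) blast
    {
      assume "S \<in> {X j -` B \<inter> ?\<Omega> | B. B \<in> UNIV}"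
      then obtain B where "S = X j -` B \<inter> ?\<Omega>" by blast
      then have "S = (\<lambda>\<omega>. (X j \<omega>, N j \<omega>)) -` (B \<times> UNIV) \<inter> ?\<Omega>" by auto
      with pair show "S \<in> sigma_sets ?\<Omega> ?G" by simp
    next
      assume "S \<in> {N j -` C \<inter> ?\<Omega> | C. C \<in> UNIV}"
      then obtain C where "S = N j -` C \<inter> ?\<Omega>" by blast
      then have "S = (\<lambda>\<omega>. (X j \<omega>, N j \<omega>)) -` (UNIV \<times> C) \<inter> ?\<Omega>" by auto
      with pair show "S \<in> sigma_sets ?\<Omega> ?G" by simp
    }
  qed
next
  let ?H = "\<Union>j\<in>{..k}. {X j -` B \<inter> ?\<Omega> | B. B \<in> UNIV} \<union> {N j -` C \<inter> ?\<Omega> | C. C \<in> UNIV}"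
  show "?G \<subseteq> sigma_sets ?\<Omega> ?H"
  proof (intro UN_least subsetI)
    fix j S assume j: "j \<in> {..k}" and "S \<in> {(\<lambda>\<omega>. (X j \<omega>, N j \<omega>)) -` A \<inter> ?\<Omega> | A. A \<in> UNIV}"
    then obtain A where A: "S = (\<lambda>\<omega>. (X j \<omega>, N j \<omega>)) -` A \<inter> ?\<Omega>" by blast
    have "X j -` {x} \<inter> ?\<Omega> \<in> sigma_sets ?\<Omega> ?H" "N j -` {s} \<inter> ?\<Omega> \<in> sigma_sets ?\<Omega> ?H" for x s
      using j by (intro sigma_sets.Basic, blast)+
    note basic = this
    have S: "S = (\<Union>z\<in>A. (X j -` {fst z} \<inter> ?\<Omega>) \<inter> (N j -` {snd z} \<inter> ?\<Omega>))"
      unfolding A by force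
    have H: "?H \<subseteq> Pow ?\<Omega>" by blast
    interpret sigma_algebra ?\<Omega> "sigma_sets ?\<Omega> ?H"
      by (rule sigma_algebra_sigma_sets[OF H])
    show "S \<in> sigma_sets ?\<Omega> ?H"
      unfolding S by (intro finite_UN Int basic finite)
  qed
qed

lemma past_mono: "j \<le> k \<Longrightarrow> past M X N j \<subseteq> past M X N k"
  unfolding past_def by (intro sigma_sets_mono' UN_mono) auto

lemma vimage_in_past:
  assumes "j \<le> k"
  shows "X j -` B \<inter> space M \<in> past M X N k" "N j -` C \<inter> space M \<in> past M X N k"
  unfolding past_def using assms by (intro sigma_sets.Basic, blast)+

lemma sigma_algebra_past: "sigma_algebra (space M) (past M X N k)"
  unfolding past_def by (rule sigma_algebra_sigma_sets) blast

lemma Int_in_past: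
  assumes "A \<in> past M X N k" "B \<in> past M X N k"
  shows "A \<inter> B \<in> past M X N k"
proof -
  interpret sigma_algebra "space M" "past M X N k" by (rule sigma_algebra_past)
  show ?thesis using assms by (rule Int)
qed

lemma space_in_tail: "space M \<in> tail_field M X N"
  by (auto simp: tail_field_def past_def sigma_sets_top)

lemma (in prob_space) prob_eq_sum_Int:
  fixes Y :: "'a \<Rightarrow> 'y::finite"
  assumes "A \<in> events" "Y \<in> measurable M (count_space UNIV)"
  shows "prob A = (\<Sum>y\<in>UNIV. prob (A \<inter> (Y -` {y} \<inter> space M)))"
proof -
  have Y: "Y -` {y} \<inter> space M \<in> events" for y
    using assms(2) by (rule measurable_sets) simp
  have "A = (\<Union>y. A \<inter> (Y -` {y} \<inter> space M))"
    using sets.sets_into_space[OF assms(1)] by blast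
  then have "prob A = prob (\<Union>y. A \<inter> (Y -` {y} \<inter> space M))" by simp
  also have "\<dots> = (\<Sum>y\<in>UNIV. prob (A \<inter> (Y -` {y} \<inter> space M)))"
    by (rule finite_measure_finite_Union) (use assms(1) Y in \<open>auto simp: disjoint_family_on_def\<close>)
  finally show ?thesis .
qed

section \<open>Markov property and tail events of a given walk\<close>

locale random_walk_process =
  fixes \<mu> :: "('v::finite \<Rightarrow> 'v) pmf" and M :: "'a measure"
    and X :: "int \<Rightarrow> 'a \<Rightarrow> 'v" and N :: "int \<Rightarrow> 'a \<Rightarrow> 'v \<Rightarrow> 'v"
  assumes walk: "random_walk \<mu> M X N"

sublocale random_walk_process \<subseteq> prob_space M
  using walk by (simp add: random_walk_def)

context random_walk_process
begin

lemma X_meas: "X k \<in> measurable M (count_space UNIV)"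
  and N_meas: "N k \<in> measurable M (count_space UNIV)"
  and N_law: "distr M (count_space UNIV) (N k) = measure_pmf \<mu>"
  and X_step: "AE \<omega> in M. X k \<omega> = N k \<omega> (X (k - 1) \<omega>)"
  using walk by (auto simp: random_walk_def)

lemma N_indep: "indep_set {N k -` C \<inter> space M | C. C \<in> UNIV} (past M X N (k - 1))"
  using walk by (auto simp: random_walk_def)

text \<open>\<open>indep_set\<close> includes that both families consist of events, and the past of
  time \<open>k\<close> occurs in the independence condition at time \<open>k + 1\<close>.\<close>

lemma past_events: "past M X N k \<subseteq> events"
  using indep_setD_ev2[OF N_indep[of "k + 1"]] by simp

lemma vimage_events: "X k -` B \<inter> space M \<in> events" "N k -` C \<inter> space M \<in> events"
  using X_meas[of k] N_meas[of k] by (auto intro: measurable_sets)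

abbreviation Z :: "int \<Rightarrow> 'a \<Rightarrow> 'v \<times> ('v \<Rightarrow> 'v)" where
  "Z k \<omega> \<equiv> (X k \<omega>, N k \<omega>)"

lemma Z_in_past:
  assumes "j \<le> k" shows "Z j -` {z} \<inter> space M \<in> past M X N k"
proof -
  have "Z j -` {z} \<inter> space M = (X j -` {fst z} \<inter> space M) \<inter> (N j -` {snd z} \<inter> space M)"
    by (cases z) auto
  also have "\<dots> \<in> past M X N k"
    by (intro Int_in_past vimage_in_past assms)
  finally show ?thesis .
qed

lemma prob_N: "prob (N k -` {s} \<inter> space M) = pmf \<mu> s"
proof -
  have "pmf \<mu> s = measure (distr M (count_space UNIV) (N k)) {s}"
    by (simp add: N_law pmf.rep_eq)
  then show ?thesis using N_meas[of k] by (simp add: measure_distr)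
qed

text \<open>On \<open>F\<close> the walk is at \<open>x\<close> at time \<open>k - 1\<close>. So, up
  to a null set, the new pair is \<open>(y, s)\<close> exactly when the fresh map is
  \<open>s\<close> and \<open>s x = y\<close>; the fresh map is independent of
  \<open>F\<close>.\<close>

lemma prob_step:
  assumes F: "F \<in> past M X N (k - 1)" and sub: "F \<subseteq> X (k - 1) -` {x}"
  shows "prob (F \<inter> (Z k -` {z} \<inter> space M)) = prob F * pmf (move_law \<mu> x) z"
proof (cases z)
  case (Pair y s)
  have Fe: "F \<in> events" using F past_events by blast
  have Ze: "Z k -` {z} \<inter> space M \<in> events" using Z_in_past[of k k z] past_events by blast
  show ?thesis
  proof (cases "s x = y")
    case True
    have "prob (F \<inter> (Z k -` {z} \<inter> space M)) = prob ((N k -` {s} \<inter> space M) \<inter> F)"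
    proof (rule measure_eq_AE)
      show "AE \<omega> in M. \<omega> \<in> F \<inter> (Z k -` {z} \<inter> space M) \<longleftrightarrow> \<omega> \<in> (N k -` {s} \<inter> space M) \<inter> F"
        using X_step[of k] by eventually_elim (use sub True Pair in auto)
    qed (use Fe Ze vimage_events in auto)
    also have "\<dots> = prob (N k -` {s} \<inter> space M) * prob F"
      by (rule indep_setD[OF N_indep _ F]) blast
    finally show ?thesis using True Pair by (simp add: prob_N pmf_move_law)
  next
    case False
    have "prob (F \<inter> (Z k -` {z} \<inter> space M)) = prob {}"
    proof (rule measure_eq_AE)
      show "AE \<omega> in M. \<omega> \<in> F \<inter> (Z k -` {z} \<inter> space M) \<longleftrightarrow> \<omega> \<in> {}"
        using X_step[of k] by eventually_elim (use sub False Pair in auto)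
    qed (use Fe Ze in auto)
    then show ?thesis using False Pair by (simp add: pmf_move_law)
  qed
qed

lemma prob_step_sum:
  assumes F: "F \<in> past M X N (k - 1)"
  shows "prob (F \<inter> (Z k -` {z} \<inter> space M))
    = (\<Sum>x\<in>UNIV. prob (F \<inter> (X (k - 1) -` {x} \<inter> space M)) * pmf (move_law \<mu> x) z)"
proof -
  have ev: "F \<inter> (Z k -` {z} \<inter> space M) \<in> events"
    using F past_events Z_in_past[of k k z] by blast
  have "prob (F \<inter> (Z k -` {z} \<inter> space M))
      = (\<Sum>x\<in>UNIV. prob (F \<inter> (Z k -` {z} \<inter> space M) \<inter> (X (k - 1) -` {x} \<inter> space M)))"
    by (rule prob_eq_sum_Int[OF ev X_meas])
  also have "\<dots> = (\<Sum>x\<in>UNIV. prob (F \<inter> (X (k - 1) -` {x} \<inter> space M)) * pmf (move_law \<mu> x) z)"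
  proof (rule sum.cong[OF refl])
    fix x
    have "F \<inter> (Z k -` {z} \<inter> space M) \<inter> (X (k - 1) -` {x} \<inter> space M)
        = (F \<inter> (X (k - 1) -` {x} \<inter> space M)) \<inter> (Z k -` {z} \<inter> space M)" by blast
    moreover have "F \<inter> (X (k - 1) -` {x} \<inter> space M) \<in> past M X N (k - 1)"
      by (intro Int_in_past F vimage_in_past) simp
    ultimately show "prob (F \<inter> (Z k -` {z} \<inter> space M) \<inter> (X (k - 1) -` {x} \<inter> space M))
        = prob (F \<inter> (X (k - 1) -` {x} \<inter> space M)) * pmf (move_law \<mu> x) z"
      using prob_step[of "F \<inter> (X (k - 1) -` {x} \<inter> space M)" k x z] by auto
  qed
  finally show ?thesis .
qed

lemma prob_position_step:
  assumes F: "F \<in> past M X N (k - 1)"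
  shows "prob (F \<inter> (X k -` {y} \<inter> space M))
    = (\<Sum>x\<in>UNIV. prob (F \<inter> (X (k - 1) -` {x} \<inter> space M)) * pmf (position_law \<mu> x) y)"
proof -
  have ev: "F \<inter> (X k -` {y} \<inter> space M) \<in> events"
    using F past_events vimage_events by blast
  have Z: "F \<inter> (X k -` {y} \<inter> space M) \<inter> (N k -` {s} \<inter> space M) = F \<inter> (Z k -` {(y, s)} \<inter> space M)" for s
    by auto
  have "prob (F \<inter> (X k -` {y} \<inter> space M))
      = (\<Sum>s\<in>UNIV. \<Sum>x\<in>UNIV. prob (F \<inter> (X (k - 1) -` {x} \<inter> space M)) * pmf (move_law \<mu> x) (y, s))"
    unfolding prob_eq_sum_Int[OF ev N_meas[of k]] Z prob_step_sum[OF F] ..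
  also have "\<dots> = (\<Sum>x\<in>UNIV. prob (F \<inter> (X (k - 1) -` {x} \<inter> space M)) * pmf (position_law \<mu> x) y)"
    unfolding map_fst_move_law[symmetric] pmf_map_fst_eq_sum sum_distrib_left by (rule sum.swap)
  finally show ?thesis .
qed

lemma prob_position_steps:
  assumes F: "F \<in> past M X N k"
  shows "prob (F \<inter> (X (k + int n) -` {y} \<inter> space M))
    = (\<Sum>x\<in>UNIV. prob (F \<inter> (X k -` {x} \<inter> space M)) * step_prob (position_law \<mu>) n x y)"
proof (induction n arbitrary: y)
  case 0
  show ?case by (simp add: step_prob_0 indicator_def)
next
  case (Suc n)
  let ?K = "position_law \<mu>"
  have k: "k + int (Suc n) - 1 = k + int n" by simp
  have "F \<in> past M X N (k + int (Suc n) - 1)"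
    using F past_mono[of k "k + int n"] by auto
  from prob_position_step[OF this, of y]
  have "prob (F \<inter> (X (k + int (Suc n)) -` {y} \<inter> space M))
      = (\<Sum>z\<in>UNIV. (\<Sum>x\<in>UNIV. prob (F \<inter> (X k -` {x} \<inter> space M)) * step_prob ?K n x z) * pmf (?K z) y)"
    unfolding k Suc .
  also have "\<dots> = (\<Sum>x\<in>UNIV. prob (F \<inter> (X k -` {x} \<inter> space M)) * step_prob ?K (n + 1) x y)"
    unfolding step_prob_add_eq step_prob_1 sum_distrib_left sum_distrib_right
    by (subst sum.swap) (simp add: mult_ac)
  finally show ?case by simp
qed

text \<open>\<open>F\<close> lies in the past of every time \<open>k - n\<close>, but the weights
  \<open>?a\<close> of the positions at that time vary with \<open>n\<close> and have no known
  limit. As they are at most 1, the error is bounded by a sum free of them that tends to 0; the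
  error itself does not depend on \<open>n\<close>, so it is 0.\<close>

lemma prob_tail_Int_position:
  assumes lim: "\<And>x y. (\<lambda>n. step_prob (position_law \<mu>) n x y) \<longlonglongrightarrow> pmf \<nu> y"
    and F: "F \<in> tail_field M X N"
  shows "prob (F \<inter> (X k -` {y} \<inter> space M)) = prob F * pmf \<nu> y"
proof -
  let ?s = "step_prob (position_law \<mu>)"
  have F_past: "F \<in> past M X N j" for j using F by (auto simp: tail_field_def)
  have Fe: "F \<in> events" using F_past past_events by blast
  have "(\<lambda>n. prob (F \<inter> (X k -` {y} \<inter> space M)) - prob F * pmf \<nu> y) \<longlonglongrightarrow> 0"
  proof (rule Lim_null_comparison)
    show "(\<lambda>n. \<Sum>x\<in>UNIV. \<bar>?s n x y - pmf \<nu> y\<bar>) \<longlonglongrightarrow> 0"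
    proof (intro tendsto_null_sum tendsto_rabs_zero)
      show "(\<lambda>n. ?s n x y - pmf \<nu> y) \<longlonglongrightarrow> 0" for x
        using lim[of x y] by (simp add: LIM_zero_iff)
    qed
    show "\<forall>\<^sub>F n in sequentially. norm (prob (F \<inter> (X k -` {y} \<inter> space M)) - prob F * pmf \<nu> y)
        \<le> (\<Sum>x\<in>UNIV. \<bar>?s n x y - pmf \<nu> y\<bar>)"
    proof (intro always_eventually allI)
      fix n
      let ?a = "\<lambda>x. prob (F \<inter> (X (k - int n) -` {x} \<inter> space M))"
      have "prob (F \<inter> (X k -` {y} \<inter> space M)) = (\<Sum>x\<in>UNIV. ?a x * ?s n x y)"
        using prob_position_steps[OF F_past, of "k - int n" n y] by simp
      moreover have "prob F = (\<Sum>x\<in>UNIV. ?a x)" by (rule prob_eq_sum_Int[OF Fe X_meas])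
      ultimately have "prob (F \<inter> (X k -` {y} \<inter> space M)) - prob F * pmf \<nu> y
          = (\<Sum>x\<in>UNIV. ?a x * (?s n x y - pmf \<nu> y))"
        by (simp add: sum_distrib_right right_diff_distrib sum_subtractf)
      also have "norm \<dots> \<le> (\<Sum>x\<in>UNIV. \<bar>?s n x y - pmf \<nu> y\<bar>)"
        by (rule sum_norm_le) (auto simp: abs_mult intro!: mult_left_le_one_le)
      finally show "norm (prob (F \<inter> (X k -` {y} \<inter> space M)) - prob F * pmf \<nu> y)
        \<le> (\<Sum>x\<in>UNIV. \<bar>?s n x y - pmf \<nu> y\<bar>)" .
    qed
  qed
  then show ?thesis by (simp add: LIMSEQ_const_iff)
qed

text \<open>The position at time \<open>m - 1\<close> is independent of \<open>F\<close>, and the later moves depend on the past only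
  through that position.\<close>

lemma prob_tail_Int_cylinder:
  assumes lim: "\<And>x y. (\<lambda>n. step_prob (position_law \<mu>) n x y) \<longlonglongrightarrow> pmf \<nu> y"
    and F: "F \<in> tail_field M X N"
  shows "F \<inter> {\<omega> \<in> space M. \<forall>i\<le>n. Z (m + int i) \<omega> = z i} \<in> past M X N (m + int n) \<and>
    prob (F \<inter> {\<omega> \<in> space M. \<forall>i\<le>n. Z (m + int i) \<omega> = z i})
      = prob F * (pmf (bind_pmf \<nu> (move_law \<mu>)) (z 0) * (\<Prod>i<n. pmf (move_law \<mu> (fst (z i))) (z (Suc i))))"
\<comment> \<open>Membership in the past is carried through the induction because
  \<open>prob_step\<close> asks for it at the next step.\<close>
proof (induction n)
  case 0
  have F_past: "F \<in> past M X N j" for j using F by (auto simp: tail_field_def)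
  have eq: "F \<inter> {\<omega> \<in> space M. \<forall>i\<le>0. Z (m + int i) \<omega> = z i} = F \<inter> (Z m -` {z 0} \<inter> space M)" by auto
  have "prob (F \<inter> (Z m -` {z 0} \<inter> space M))
      = (\<Sum>x\<in>UNIV. prob F * pmf \<nu> x * pmf (move_law \<mu> x) (z 0))"
    unfolding prob_step_sum[OF F_past] prob_tail_Int_position[OF assms] ..
  also have "\<dots> = prob F * pmf (bind_pmf \<nu> (move_law \<mu>)) (z 0)"
    by (simp add: pmf_bind integral_measure_pmf_real[of UNIV] sum_distrib_left mult_ac)
  finally show ?case unfolding eq using Int_in_past[OF F_past Z_in_past] by simp
next
  case (Suc n)
  let ?C = "F \<inter> {\<omega> \<in> space M. \<forall>i\<le>n. Z (m + int i) \<omega> = z i}"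
  let ?k = "m + int (Suc n)"
  have k: "?k - 1 = m + int n" by simp
  have eq: "F \<inter> {\<omega> \<in> space M. \<forall>i\<le>Suc n. Z (m + int i) \<omega> = z i} = ?C \<inter> (Z ?k -` {z (Suc n)} \<inter> space M)"
    by (auto simp: le_Suc_eq)
  have C: "?C \<in> past M X N (?k - 1)" unfolding k using Suc by blast
  have "?C \<subseteq> X (?k - 1) -` {fst (z n)}" unfolding k
  proof
    fix \<omega> assume "\<omega> \<in> ?C"
    then have "Z (m + int n) \<omega> = z n" by simp
    then have "fst (Z (m + int n) \<omega>) = fst (z n)" by (rule arg_cong)
    then show "\<omega> \<in> X (m + int n) -` {fst (z n)}" by simp
  qed
  from prob_step[OF C this, of "z (Suc n)"] Suc
  have "prob (?C \<inter> (Z ?k -` {z (Suc n)} \<inter> space M))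
      = prob F * (pmf (bind_pmf \<nu> (move_law \<mu>)) (z 0) * (\<Prod>i<Suc n. pmf (move_law \<mu> (fst (z i))) (z (Suc i))))"
    by simp
  moreover have "?C \<in> past M X N ?k" using C past_mono[of "?k - 1" ?k] by auto
  then have "?C \<inter> (Z ?k -` {z (Suc n)} \<inter> space M) \<in> past M X N ?k"
    by (rule Int_in_past) (rule Z_in_past, simp)
  ultimately show ?case unfolding eq by blast
qed

lemma Z_meas: "Z k \<in> measurable M (count_space UNIV)"
proof -
  have "Z k \<in> measurable M (count_space UNIV \<Otimes>\<^sub>M count_space UNIV)"
    by (intro measurable_Pair X_meas N_meas)
  then show ?thesis by (simp add: pair_measure_countable)
qed

lemma path_meas: "(\<lambda>\<omega> k. Z (k + a) \<omega>) \<in> measurable M (Pi\<^sub>M UNIV (\<lambda>_. count_space UNIV))"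
  by (rule measurable_PiM_single') (auto intro: Z_meas)

text \<open>The shift \<open>a\<close> occurs on the left only: cylinder probabilities do not depend
  on the starting time of the cylinder, and this is the source of stationarity.\<close>

lemma tail_density_eq:
  assumes lim: "\<And>x y. (\<lambda>n. step_prob (position_law \<mu>) n x y) \<longlonglongrightarrow> pmf \<nu> y"
    and F: "F \<in> tail_field M X N"
    and L: "prob_space L" "sets L = sets (Pi\<^sub>M UNIV (\<lambda>_. count_space UNIV))"
      "\<And>m n z. measure L {f. \<forall>i\<le>n. f (m + int i) = z i}
        = pmf (bind_pmf \<nu> (move_law \<mu>)) (z 0) * (\<Prod>i<n. pmf (move_law \<mu> (fst (z i))) (z (Suc i)))"
  shows "distr (density M (indicator F)) (Pi\<^sub>M UNIV (\<lambda>_. count_space UNIV)) (\<lambda>\<omega> k. Z (k + a) \<omega>)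
       = scale_measure (emeasure M F) L" (is "?D = ?S")
proof (rule measure_eqI_cyl)
  interpret L: prob_space L by (rule L(1))
  have Fe: "F \<in> events" using F past_events by (auto simp: tail_field_def)
  have D: "emeasure ?D B = emeasure M (F \<inter> ((\<lambda>\<omega> k. Z (k + a) \<omega>) -` B \<inter> space M))"
    if B: "B \<in> sets (Pi\<^sub>M UNIV (\<lambda>_. count_space UNIV))" for B
  proof -
    have "(\<lambda>\<omega> k. Z (k + a) \<omega>) -` B \<inter> space M \<in> events" by (rule measurable_sets[OF path_meas B])
    then show ?thesis
      using B Fe path_meas by (subst emeasure_distr) (simp_all add: emeasure_restricted)
  qed
  show "sets ?D = sets (Pi\<^sub>M UNIV (\<lambda>_. count_space UNIV))" by simp
  show "sets ?S = sets (Pi\<^sub>M UNIV (\<lambda>_. count_space UNIV))" by (simp add: L)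
  show "finite_measure ?D"
  proof
    have "emeasure ?D (space ?D) = emeasure M (F \<inter> ((\<lambda>\<omega> k. Z (k + a) \<omega>) -` space ?D \<inter> space M))"
      using sets.top[of ?D] by (intro D) simp
    also have "\<dots> \<noteq> \<infinity>" by simp
    finally show "emeasure ?D (space ?D) \<noteq> \<infinity>" .
  qed
  \<comment> \<open>Half-open, so that the window for \<open>n = 0\<close> is empty, as
    \<open>measure_eqI_cyl\<close> requires.\<close>
  let ?W = "\<lambda>n. {- int n..<int n}"
  show "incseq ?W" by (auto simp: incseq_def)
  show "finite (?W n)" for n by simp
  show "?W 0 = {}" by simp
  show "(\<Union>n. ?W n) = UNIV"
  proof (intro set_eqI iffI)
    fix i :: int assume "i \<in> UNIV"
    have "i \<in> ?W (nat \<bar>i\<bar> + 1)" by auto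
    then show "i \<in> (\<Union>n. ?W n)" by blast
  qed simp
  fix n and z :: "int \<Rightarrow> 'v \<times> ('v \<Rightarrow> 'v)"
  let ?A = "{f. \<forall>i\<in>?W n. f i = z i}"
  have A: "?A \<in> sets (Pi\<^sub>M UNIV (\<lambda>_. count_space UNIV))"
  proof -
    have "{f \<in> space (Pi\<^sub>M UNIV (\<lambda>_. count_space UNIV)). \<forall>i\<in>?W n. f i = z i}
        \<in> sets (Pi\<^sub>M UNIV (\<lambda>_. count_space UNIV))"
      by measurable
    then show ?thesis by (simp add: space_PiM)
  qed
  show "emeasure ?D ?A = emeasure ?S ?A"
  proof (cases n)
    case 0
    then have "?A = space L" using sets_eq_imp_space_eq[OF L(2)] by (simp add: space_PiM)
    moreover have "(\<lambda>\<omega> k. Z (k + a) \<omega>) -` ?A \<inter> space M = space M" using 0 by simp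
    moreover have "F \<inter> space M = F" using sets.sets_into_space[OF Fe] by blast
    ultimately show ?thesis using D[OF A] by (simp add: L.emeasure_space_1)
  next
    case (Suc m)
    \<comment> \<open>With \<open>n = Suc m\<close> the window has \<open>2 * n = 2 * m + 2\<close>
      points, hence offsets up to \<open>2 * m + 1\<close>.\<close>
    have window: "(\<forall>i\<in>?W n. R i) \<longleftrightarrow> (\<forall>i\<le>2 * m + 1. R (- int n + int i))" for R
    proof safe
      fix i assume "\<forall>i\<in>?W n. R i" "i \<le> 2 * m + 1"
      then show "R (- int n + int i)" using Suc by auto
    next
      fix i assume "\<forall>i\<le>2 * m + 1. R (- int n + int i)" "i \<in> ?W n"
      then show "R i" using Suc by (auto dest!: spec[of _ "nat (i + int n)"])
    qed
    let ?z = "\<lambda>i. z (- int n + int i)"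
    have "(\<lambda>\<omega> k. Z (k + a) \<omega>) -` ?A \<inter> space M
        = {\<omega> \<in> space M. \<forall>i\<le>2 * m + 1. Z ((a - int n) + int i) \<omega> = ?z i}"
      unfolding window by (auto simp: algebra_simps)
    then have "emeasure ?D ?A = ennreal (prob (F \<inter> {\<omega> \<in> space M. \<forall>i\<le>2 * m + 1. Z ((a - int n) + int i) \<omega> = ?z i}))"
      using D[OF A] by (simp add: emeasure_eq_measure)
    also have "\<dots> = ennreal (prob F) * ennreal (measure L ?A)"
      unfolding prob_tail_Int_cylinder[OF lim F, THEN conjunct2] window L(3)
      by (simp add: ennreal_mult')
    also have "\<dots> = emeasure ?S ?A"
      by (simp add: emeasure_eq_measure L.emeasure_eq_measure)
    finally show ?thesis .
  qed
qed

end

section \<open>The reference law on paths\<close>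

text \<open>The cylinder formula of a Markov chain of pairs, whose initial factor is one step of the
  walk from a position with law \<open>\<nu>\<close>. It is demanded for every starting time
  \<open>m\<close>, so stationarity is built in.\<close>

definition is_path_law ::
  "('v::finite \<Rightarrow> 'v) pmf \<Rightarrow> 'v pmf \<Rightarrow> (int \<Rightarrow> 'v \<times> ('v \<Rightarrow> 'v)) measure \<Rightarrow> bool" where
  "is_path_law \<mu> \<nu> L \<longleftrightarrow> prob_space L \<and> sets L = sets (Pi\<^sub>M UNIV (\<lambda>_. count_space UNIV)) \<and>
     (\<forall>m n z. measure L {f. \<forall>i\<le>n. f (m + int i) = z i}
        = pmf (bind_pmf \<nu> (move_law \<mu>)) (z 0) * (\<Prod>i<n. pmf (move_law \<mu> (fst (z i))) (z (Suc i))))"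

context random_walk_process
begin

context
  fixes \<nu> L
  assumes lim: "\<And>x y. (\<lambda>n. step_prob (position_law \<mu>) n x y) \<longlonglongrightarrow> pmf \<nu> y"
    and L: "is_path_law \<mu> \<nu> L"
begin

lemma tail_density_eq_path_law:
  assumes "F \<in> tail_field M X N"
  shows "distr (density M (indicator F)) (Pi\<^sub>M UNIV (\<lambda>_. count_space UNIV)) (\<lambda>\<omega> k. Z (k + a) \<omega>)
       = scale_measure (emeasure M F) L"
  using L unfolding is_path_law_def by (intro tail_density_eq[OF lim assms]) auto

lemma path_law: "distr M (Pi\<^sub>M UNIV (\<lambda>_. count_space UNIV)) (\<lambda>\<omega> k. Z (k + a) \<omega>) = L"
proof -
  have "density M (indicator (space M)) = M"
  proof (rule measure_eqI)
    fix A assume "A \<in> sets (density M (indicator (space M)))"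
    then have A: "A \<in> events" by simp
    then have "space M \<inter> A = A" using sets.sets_into_space by blast
    then show "emeasure (density M (indicator (space M))) A = emeasure M A"
      using A by (simp add: emeasure_restricted)
  qed simp
  then show ?thesis
    using tail_density_eq_path_law[OF space_in_tail, of a] by (simp add: emeasure_space_1)
qed

text \<open>The right-hand side involves neither \<open>a\<close> nor the walk, so it yields both
  uniqueness in law and stationarity. The map there unzips a path of pairs into a pair of
  paths.\<close>

lemma joint_law_shift:
  "joint_law M (\<lambda>k. X (k + a)) (\<lambda>k. N (k + a)) =
   distr L ((\<Pi>\<^sub>M k\<in>UNIV. count_space UNIV) \<Otimes>\<^sub>M (\<Pi>\<^sub>M k\<in>UNIV. count_space UNIV))
     (\<lambda>f. (\<lambda>k. fst (f k), \<lambda>k. snd (f k)))"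
proof -
  have comp: "(\<lambda>f. g (f k)) \<in> measurable (Pi\<^sub>M UNIV (\<lambda>_. count_space UNIV)) (count_space UNIV)"
    for g :: "'v \<times> ('v \<Rightarrow> 'v) \<Rightarrow> 'c" and k :: int
    by (rule measurable_compose[OF measurable_component_singleton]) auto
  have "(\<lambda>f. (\<lambda>k. fst (f k), \<lambda>k. snd (f k))) \<in> measurable (Pi\<^sub>M UNIV (\<lambda>_. count_space UNIV))
      ((\<Pi>\<^sub>M (k::int)\<in>UNIV. count_space (UNIV :: 'v set)) \<Otimes>\<^sub>M (\<Pi>\<^sub>M (k::int)\<in>UNIV. count_space (UNIV :: ('v \<Rightarrow> 'v) set)))"
    by (intro measurable_Pair measurable_PiM_single' comp) auto
  then show ?thesis
    unfolding joint_law_def path_law[of a, symmetric]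
    by (subst distr_distr[OF _ path_meas]) (simp_all add: comp_def)
qed

lemma position_law_eq: "distr M (count_space UNIV) (X k) = measure_pmf \<nu>"
proof (rule measure_eqI_finite[where A = UNIV])
  fix y
  have "emeasure (distr M (count_space UNIV) (X k)) {y} = emeasure M (X k -` {y} \<inter> space M)"
    by (rule emeasure_distr[OF X_meas]) simp
  also have "\<dots> = ennreal (pmf \<nu> y)"
    using prob_tail_Int_position[OF lim space_in_tail, of k y]
    by (simp add: emeasure_eq_measure prob_space Int_absorb1)
  finally show "emeasure (distr M (count_space UNIV) (X k)) {y} = emeasure (measure_pmf \<nu>) {y}"
    by (simp add: emeasure_pmf_single)
qed auto

text \<open>A tail event is independent of the path and determined by it, hence independent of itself.\<close>

lemma tail_trivial:
  assumes F: "F \<in> tail_field M X N"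
  shows "prob F = 0 \<or> prob F = 1"
proof -
  \<comment> \<open>Written with \<open>k + 0\<close> to match \<open>path_law\<close> at shift 0. A
    tail event lies in the past of time 0, hence in the algebra \<open>?V\<close> of events
    determined by the path.\<close>
  let ?path = "\<lambda>\<omega> k. Z (k + 0) \<omega>"
  let ?V = "vimage_algebra (space M) ?path (Pi\<^sub>M UNIV (\<lambda>_. count_space UNIV))"
  have V: "sets ?V = {?path -` B \<inter> space M | B. B \<in> sets (Pi\<^sub>M UNIV (\<lambda>_. count_space UNIV))}"
    by (rule sets_vimage_algebra2) (simp add: space_PiM)
  have "past M X N 0 \<subseteq> sets ?V"
  proof -
    have "Z j -` A \<inter> space M \<in> sets ?V" for j A
    proof -
      have "(\<lambda>f. f j) -` A \<inter> space (Pi\<^sub>M UNIV (\<lambda>_. count_space UNIV)) \<in> sets (Pi\<^sub>M UNIV (\<lambda>_. count_space (UNIV :: ('v \<times> ('v \<Rightarrow> 'v)) set)))"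
        by (rule measurable_sets[OF measurable_component_singleton]) auto
      moreover have "Z j -` A \<inter> space M = ?path -` ((\<lambda>f. f j) -` A \<inter> space (Pi\<^sub>M UNIV (\<lambda>_. count_space UNIV))) \<inter> space M"
        by (auto simp: space_PiM)
      ultimately show ?thesis unfolding V by blast
    qed
    then have "(\<Union>j\<in>{..0}. {Z j -` A \<inter> space M | A. A \<in> UNIV}) \<subseteq> sets ?V" by blast
    from sets.sigma_sets_subset[OF this] show ?thesis
      unfolding past_eq_sigma_pairs by simp
  qed
  then obtain B where B: "B \<in> sets (Pi\<^sub>M UNIV (\<lambda>_. count_space UNIV))" "F = ?path -` B \<inter> space M"
    using F V by (auto simp: tail_field_def)
  have Fe: "F \<in> events" using F past_events by (auto simp: tail_field_def)
  have "emeasure L B = emeasure M F"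
    unfolding path_law[of 0, symmetric] B(2) by (rule emeasure_distr[OF path_meas B(1)])
  \<comment> \<open>The restriction to \<open>F\<close> gives the path set \<open>B\<close> the mass
    of \<open>F\<close> itself. By \<open>tail_density_eq_path_law\<close> this mass is also the
    probability of \<open>F\<close> times the mass of \<open>B\<close> under \<open>L\<close>, that
    is, the square of the probability of \<open>F\<close>.\<close>
  moreover have "emeasure (distr (density M (indicator F)) (Pi\<^sub>M UNIV (\<lambda>_. count_space UNIV)) ?path) B
      = emeasure (density M (indicator F)) F"
    using B path_meas[of 0] by (subst emeasure_distr) auto
  then have "emeasure (distr (density M (indicator F)) (Pi\<^sub>M UNIV (\<lambda>_. count_space UNIV)) ?path) B
      = emeasure M F"
    using Fe by (simp add: emeasure_restricted)
  ultimately have "ennreal (prob F) = ennreal (prob F) * ennreal (prob F)"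
    unfolding tail_density_eq_path_law[OF F] by (simp add: emeasure_eq_measure)
  then have "prob F = prob F * prob F"
    by (simp flip: ennreal_mult')
  then show ?thesis by auto
qed

end

end

section \<open>The coordinates under the path law form a random walk\<close>

text \<open>Peel off the largest index: the events belonging to the smaller ones lie in its
  past.\<close>

lemma (in prob_space) indep_vars_if_indep_past:
  fixes N :: "int \<Rightarrow> 'a \<Rightarrow> 'v \<Rightarrow> 'v" and X :: "int \<Rightarrow> 'a \<Rightarrow> 'v"
  assumes meas: "\<And>k. N k \<in> measurable M (count_space UNIV)"
    and indep: "\<And>k. indep_set {N k -` C \<inter> space M | C. C \<in> UNIV} (past M X N (k - 1))"
  shows "indep_vars (\<lambda>_. count_space UNIV) N UNIV"
  unfolding indep_vars_def2
proof (intro conjI ballI indep_setsI)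
  show "N k \<in> measurable M (count_space UNIV)" for k by (rule meas)
  show "{N k -` A \<inter> space M | A. A \<in> sets (count_space UNIV)} \<subseteq> events" for k
    using meas[of k] by (auto intro: measurable_sets)
  fix A and J :: "int set"
  assume "J \<noteq> {}" "finite J" and A: "\<forall>j\<in>J. A j \<in> {N j -` A \<inter> space M | A. A \<in> sets (count_space UNIV)}"
  \<comment> \<open>Intersecting with \<open>space M\<close> gives the empty intersection the right
    value, so that the induction can start at the empty index set.\<close>
  have "prob (space M \<inter> (\<Inter>j\<in>J. A j)) = (\<Prod>j\<in>J. prob (A j)) \<and>
      (\<forall>k. J \<subseteq> {..k} \<longrightarrow> space M \<inter> (\<Inter>j\<in>J. A j) \<in> past M X N k)"
    using \<open>finite J\<close> A
  proof (induction rule: finite_linorder_max_induct)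
    case empty
    then show ?case by (simp add: prob_space past_def sigma_sets_top)
  next
    case (insert b J)
    let ?I = "space M \<inter> (\<Inter>j\<in>J. A j)"
    have IH: "prob ?I = (\<Prod>j\<in>J. prob (A j))" "\<And>k. J \<subseteq> {..k} \<Longrightarrow> ?I \<in> past M X N k"
      using insert by auto
    have b: "A b \<in> {N b -` C \<inter> space M | C. C \<in> UNIV}" using insert.prems by simp
    have eq: "space M \<inter> (\<Inter>j\<in>insert b J. A j) = A b \<inter> ?I" by auto
    have "J \<subseteq> {..b - 1}" using insert.hyps by force
    then have "prob (A b \<inter> ?I) = prob (A b) * prob ?I"
      using indep_setD[OF indep b IH(2)] by blast
    moreover have "b \<notin> J" using insert.hyps by force
    ultimately have "prob (A b \<inter> ?I) = (\<Prod>j\<in>insert b J. prob (A j))"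
      using insert.hyps IH(1) by simp
    moreover have "A b \<inter> ?I \<in> past M X N k" if k: "insert b J \<subseteq> {..k}" for k
    proof (rule Int_in_past)
      show "A b \<in> past M X N k" using b k vimage_in_past(2)[of b k] by auto
      show "?I \<in> past M X N k" using k by (intro IH(2)) simp
    qed
    ultimately show ?case unfolding eq by blast
  qed
  moreover have "space M \<inter> (\<Inter>j\<in>J. A j) = (\<Inter>j\<in>J. A j)"
    using \<open>J \<noteq> {}\<close> A by blast
  ultimately show "prob (\<Inter>j\<in>J. A j) = (\<Prod>j\<in>J. prob (A j))" by simp
qed

lemma pmf_map_snd_eq_sum:
  fixes p :: "('a::finite \<times> 'b) pmf"
  shows "pmf (map_pmf snd p) s = (\<Sum>x\<in>UNIV. pmf p (x, s))"
proof -
  have "snd -` {s} = (\<lambda>x. (x, s)) ` (UNIV :: 'a set)" by auto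
  then show ?thesis
    by (simp add: pmf_map measure_measure_pmf_finite sum.reindex inj_on_def)
qed

context
  fixes \<mu> :: "('v::finite \<Rightarrow> 'v) pmf" and \<nu> L
  assumes path_law_L: "is_path_law \<mu> \<nu> L"
begin

interpretation L: prob_space L
  using path_law_L by (simp add: is_path_law_def)

lemma sets_L: "sets L = sets (Pi\<^sub>M UNIV (\<lambda>_. count_space UNIV))"
  using path_law_L by (simp add: is_path_law_def)

lemma space_L: "space L = UNIV"
  using sets_eq_imp_space_eq[OF sets_L] by (simp add: space_PiM)

lemma prob_L: "L.prob {f. \<forall>i\<le>n. f (m + int i) = z i}
    = pmf (bind_pmf \<nu> (move_law \<mu>)) (z 0) * (\<Prod>i<n. pmf (move_law \<mu> (fst (z i))) (z (Suc i)))"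
  using path_law_L by (simp add: is_path_law_def)

lemma coord_meas: "(\<lambda>f. g (f k)) \<in> measurable L (count_space UNIV)"
  unfolding measurable_cong_sets[OF sets_L refl]
  by (rule measurable_compose[OF measurable_component_singleton]) auto

lemma coord_events: "{f. R (f k)} \<in> L.events"
  using measurable_sets[OF coord_meas[of R k], of "{True}"] by (simp add: vimage_def space_L)

lemma cylinder_events: "{f. \<forall>i\<le>n. f (m + int i) = z i} \<in> L.events"
proof -
  have "{f \<in> space L. \<forall>i\<in>{..n}. f (m + int i) = z i} \<in> L.events"
    using coord_events by (intro sets.sets_Collect_finite_All) (auto simp: space_L)
  then show ?thesis by (simp add: space_L Ball_def)
qed

text \<open>Extend the window by \<open>(y, s)\<close> at time \<open>k\<close> and sum over the
  position \<open>y\<close>: the map component of \<open>move_law \<mu> x\<close> has law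
  \<open>\<mu>\<close> whatever the position \<open>x\<close> at time \<open>k - 1\<close>.\<close>

lemma prob_next_step:
  "L.prob ({f. \<forall>i\<le>n. f (k - 1 - int n + int i) = z i} \<inter> {f. snd (f k) = s})
     = L.prob {f. \<forall>i\<le>n. f (k - 1 - int n + int i) = z i} * pmf \<mu> s"
proof -
  let ?C = "{f. \<forall>i\<le>n. f (k - 1 - int n + int i) = z i}"
  have cond: "L.prob (?C \<inter> {f. snd (f k) = s} \<inter> ((\<lambda>f. fst (f k)) -` {y} \<inter> space L))
      = L.prob ?C * pmf (move_law \<mu> (fst (z n))) (y, s)" for y
  proof -
    have "?C \<inter> {f. snd (f k) = s} \<inter> ((\<lambda>f. fst (f k)) -` {y} \<inter> space L)
        = {f. \<forall>i\<le>Suc n. f (k - 1 - int n + int i) = (z(Suc n := (y, s))) i}"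
      by (auto simp: le_Suc_eq space_L prod_eq_iff)
    then show ?thesis unfolding prob_L by (simp add: prob_L)
  qed
  have "L.prob (?C \<inter> {f. snd (f k) = s}) = (\<Sum>y\<in>UNIV. L.prob ?C * pmf (move_law \<mu> (fst (z n))) (y, s))"
    unfolding cond[symmetric]
    by (intro L.prob_eq_sum_Int sets.Int cylinder_events coord_events coord_meas)
  also have "\<dots> = L.prob ?C * pmf \<mu> s"
    by (simp only: sum_distrib_left[symmetric] pmf_map_snd_eq_sum[symmetric] map_snd_move_law)
  finally show ?thesis .
qed

lemma prob_snd_eq: "L.prob {f. snd (f k) = s} = pmf \<mu> s"
proof -
  have cond: "L.prob ({f. snd (f k) = s} \<inter> ((\<lambda>f. fst (f k)) -` {y} \<inter> space L)) = pmf (bind_pmf \<nu> (move_law \<mu>)) (y, s)" for y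
  proof -
    have "{f. snd (f k) = s} \<inter> ((\<lambda>f. fst (f k)) -` {y} \<inter> space L) = {f. \<forall>i\<le>0. f (k + int i) = (\<lambda>_. (y, s)) i}"
      by (auto simp: space_L prod_eq_iff)
    then show ?thesis by (simp only: prob_L) simp
  qed
  have "L.prob {f. snd (f k) = s} = (\<Sum>y\<in>UNIV. pmf (bind_pmf \<nu> (move_law \<mu>)) (y, s))"
    unfolding cond[symmetric] by (intro L.prob_eq_sum_Int coord_events coord_meas)
  also have "\<dots> = pmf \<mu> s"
    by (simp only: pmf_map_snd_eq_sum[symmetric] map_bind_pmf map_snd_move_law bind_pmf_const)
  finally show ?thesis .
qed

text \<open>Windows with fixed right end \<open>k - 1\<close> that grow to the left give an
  intersection-stable generator of the past, on which the product formula is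
  \<open>prob_next_step\<close>.\<close>

lemma indep_next_step:
  "L.indep_set {(\<lambda>f. snd (f k)) -` C \<inter> space L | C. C \<in> UNIV}
     (past L (\<lambda>k f. fst (f k)) (\<lambda>k f. snd (f k)) (k - 1))"
proof -
  let ?W = "\<lambda>n. {k - 1 - int n..k - 1}"
  let ?G = "insert {} {cyl UNIV (\<lambda>i f. f i) (?W n) z | n z. True} :: (int \<Rightarrow> 'v \<times> ('v \<Rightarrow> 'v)) set set"
  let ?N = "{(\<lambda>f. snd (f k)) -` C \<inter> space L | C. C \<in> UNIV}"
  have "(\<Union>n. ?W n) = {..k - 1}"
  proof (intro set_eqI iffI)
    fix i assume "i \<in> {..k - 1}"
    then have "i \<in> ?W (nat (k - 1 - i))" by auto
    then show "i \<in> (\<Union>n. ?W n)" by blast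
  qed auto
  then have past: "past L (\<lambda>k f. fst (f k)) (\<lambda>k f. snd (f k)) (k - 1) = sigma_sets (space L) ?G"
    unfolding past_eq_sigma_pairs space_L prod.collapse by (intro sigma_cyl) simp_all
  have cyl_eq: "cyl UNIV (\<lambda>i f. f i) (?W n) z
      = {f. \<forall>i\<le>n. f (k - 1 - int n + int i) = z (k - 1 - int n + int i)}" for n z
  proof -
    have "(\<forall>i\<in>?W n. R i) \<longleftrightarrow> (\<forall>i\<le>n. R (k - 1 - int n + int i))" for R
    proof safe
      fix i assume "\<forall>i\<in>?W n. R i" "i \<le> n"
      then show "R (k - 1 - int n + int i)" by auto
    next
      fix i assume "\<forall>i\<le>n. R (k - 1 - int n + int i)" "i \<in> ?W n"
      then show "R i" by (auto dest!: spec[of _ "nat (i - (k - 1 - int n))"])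
    qed
    then show ?thesis by (simp add: cyl_def)
  qed
  have cond: "L.prob (A \<inter> {f. snd (f k) \<in> C}) = L.prob A * (\<Sum>s\<in>C. pmf \<mu> s)"
    if A: "A \<in> L.events" and s: "\<And>s. L.prob (A \<inter> {f. snd (f k) = s}) = L.prob A * pmf \<mu> s" for A C
  proof -
    have "L.prob (A \<inter> {f. snd (f k) \<in> C})
        = (\<Sum>s\<in>UNIV. L.prob (A \<inter> {f. snd (f k) \<in> C} \<inter> ((\<lambda>f. snd (f k)) -` {s} \<inter> space L)))"
      by (intro L.prob_eq_sum_Int coord_meas sets.Int A coord_events)
    also have "\<dots> = (\<Sum>s\<in>UNIV. if s \<in> C then L.prob A * pmf \<mu> s else 0)"
    proof (rule sum.cong[OF refl])
      fix s
      have "A \<inter> {f. snd (f k) \<in> C} \<inter> ((\<lambda>f. snd (f k)) -` {s} \<inter> space L)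
          = (if s \<in> C then A \<inter> {f. snd (f k) = s} else {})"
        by (auto simp: space_L)
      then show "L.prob (A \<inter> {f. snd (f k) \<in> C} \<inter> ((\<lambda>f. snd (f k)) -` {s} \<inter> space L))
          = (if s \<in> C then L.prob A * pmf \<mu> s else 0)"
        by (simp add: s)
    qed
    also have "\<dots> = L.prob A * (\<Sum>s\<in>C. pmf \<mu> s)"
      by (simp add: sum.If_cases sum_distrib_left)
    finally show ?thesis .
  qed
  have "L.indep_set ?N ?G"
  proof (rule L.indep_setI)
    show "?N \<subseteq> L.events"
      using measurable_sets[OF coord_meas[of snd k]] by auto
    show "?G \<subseteq> L.events"
      using cylinder_events by (auto simp: cyl_eq)
    fix A B assume "A \<in> ?N" and B: "B \<in> ?G"
    then obtain C where C: "A = {f. snd (f k) \<in> C}" by (auto simp: space_L vimage_def)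
    have "L.prob A = (\<Sum>s\<in>C. pmf \<mu> s)"
      using cond[of UNIV C] sets.top[of L] L.prob_space by (simp add: C space_L prob_snd_eq)
    moreover have "L.prob (B \<inter> A) = L.prob B * (\<Sum>s\<in>C. pmf \<mu> s)"
      unfolding C
    proof (rule cond)
      show "B \<in> L.events" using B cylinder_events by (auto simp: cyl_eq)
      show "L.prob (B \<inter> {f. snd (f k) = s}) = L.prob B * pmf \<mu> s" for s
        using B prob_next_step by (auto simp: cyl_eq)
    qed
    ultimately show "L.prob (A \<inter> B) = L.prob A * L.prob B" by (simp add: Int_commute mult.commute)
  qed
  moreover have "Int_stable ?N"
    unfolding Int_stable_def
  proof safe
    fix C D
    have "((\<lambda>f. snd (f k)) -` C \<inter> space L) \<inter> ((\<lambda>f. snd (f k)) -` D \<inter> space L)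
        = (\<lambda>f. snd (f k)) -` (C \<inter> D) \<inter> space L" by blast
    then show "\<exists>E. ((\<lambda>f. snd (f k)) -` C \<inter> space L) \<inter> ((\<lambda>f. snd (f k)) -` D \<inter> space L)
        = (\<lambda>f. snd (f k)) -` E \<inter> space L \<and> E \<in> UNIV" by blast
  qed
  moreover have "Int_stable ?G"
    by (rule Int_stable_cyl) (auto simp: incseq_def)
  ultimately have "L.indep_set (sigma_sets (space L) ?N) (sigma_sets (space L) ?G)"
    by (rule L.indep_set_sigma_sets)
  then show ?thesis
    unfolding past L.indep_sets2_eq by (auto intro: sigma_sets.Basic)
qed

lemma random_walk_path_law: "random_walk \<mu> L (\<lambda>k f. fst (f k)) (\<lambda>k f. snd (f k))"
  unfolding random_walk_def
proof (intro conjI allI)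
  show "prob_space L" by (rule L.prob_space_axioms)
  show "(\<lambda>f. fst (f k)) \<in> measurable L (count_space UNIV)"
    "(\<lambda>f. snd (f k)) \<in> measurable L (count_space UNIV)" for k
    by (rule coord_meas)+
  show "L.indep_set {(\<lambda>f. snd (f k)) -` C \<inter> space L | C. C \<in> UNIV}
     (past L (\<lambda>k f. fst (f k)) (\<lambda>k f. snd (f k)) (k - 1))" for k
    by (rule indep_next_step)
  show "L.indep_vars (\<lambda>_. count_space UNIV) (\<lambda>k f. snd (f k)) UNIV"
    by (rule L.indep_vars_if_indep_past[OF coord_meas indep_next_step])
  show "distr L (count_space UNIV) (\<lambda>f. snd (f k)) = measure_pmf \<mu>" for k
  proof (rule measure_eqI_finite[where A = UNIV])
    fix s
    have "emeasure (distr L (count_space UNIV) (\<lambda>f. snd (f k))) {s} = emeasure L {f. snd (f k) = s}"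
      by (subst emeasure_distr[OF coord_meas]) (simp_all add: vimage_def space_L)
    then show "emeasure (distr L (count_space UNIV) (\<lambda>f. snd (f k))) {s} = emeasure (measure_pmf \<mu>) {s}"
      by (simp add: L.emeasure_eq_measure prob_snd_eq emeasure_pmf_single)
  qed auto
  show "AE f in L. fst (f k) = snd (f k) (fst (f (k - 1)))" for k
  proof -
    \<comment> \<open>Two consecutive states that violate the step equation form a two-point
      cylinder whose product contains the factor 0, and there are only finitely many such
      combinations.\<close>
    have "AE f in L. \<not> (f (k - 1) = z \<and> f k = (y, s))" if "s (fst z) \<noteq> y" for z y s
    proof -
      let ?A = "{f. \<forall>i\<le>1. f (k - 1 + int i) = (\<lambda>i. if i = 0 then z else (y, s)) i}"
      have "L.prob ?A = 0"
        unfolding prob_L using that by (simp add: pmf_move_law)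
      then have "?A \<in> null_sets L"
        using cylinder_events by (intro null_setsI) (auto simp: L.emeasure_eq_measure)
      then have "AE f in L. f \<notin> ?A" by (rule AE_not_in)
      then show ?thesis
        by eventually_elim (auto simp: le_Suc_eq)
    qed
    then have "AE f in L. \<forall>z y s. s (fst z) \<noteq> y \<longrightarrow> \<not> (f (k - 1) = z \<and> f k = (y, s))"
      by (simp add: AE_all_countable)
    then show ?thesis
      by eventually_elim (metis prod.collapse)
  qed
qed

end

text \<open>One step from \<open>\<nu>\<close> gives a stationary law of the pair chain: its
  position component is again \<open>\<nu>\<close>, and the next pair depends on nothing
  else.\<close>

lemma is_path_law_exists:
  assumes "bind_pmf \<nu> (position_law \<mu>) = \<nu>"
  obtains L where "is_path_law \<mu> \<nu> L"
proof -
  have "bind_pmf (bind_pmf \<nu> (move_law \<mu>)) (\<lambda>z. move_law \<mu> (fst z))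
      = bind_pmf (bind_pmf \<nu> (\<lambda>x. map_pmf fst (move_law \<mu> x))) (move_law \<mu>)"
    by (simp add: bind_assoc_pmf bind_map_pmf)
  then have "bind_pmf (bind_pmf \<nu> (move_law \<mu>)) (\<lambda>z. move_law \<mu> (fst z)) = bind_pmf \<nu> (move_law \<mu>)"
    by (simp add: map_fst_move_law assms)
  from stationary_chain_exists[OF this] obtain L where "prob_space L"
    "sets L = sets (Pi\<^sub>M UNIV (\<lambda>_. count_space UNIV))"
    "\<And>m n z. measure L {f. \<forall>i\<le>n. f (m + int i) = z i}
      = pmf (bind_pmf \<nu> (move_law \<mu>)) (z 0) * (\<Prod>i<n. pmf (move_law \<mu> (fst (z i))) (z (Suc i)))"
    by blast
  then have "is_path_law \<mu> \<nu> L" unfolding is_path_law_def by blast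
  then show ?thesis by (rule that)
qed

section \<open>Convolution and induced graph in terms of the position chain\<close>

lemma pmf_bind_position_law: "pmf (bind_pmf \<nu> (position_law \<mu>)) y = conv_law \<mu> \<nu> y"
proof -
  have "pmf (position_law \<mu> x) y = (\<Sum>\<sigma>\<in>UNIV. pmf \<mu> \<sigma> * indicator {x. \<sigma> x = y} x)" for x
  proof -
    have "pmf \<mu> \<sigma> * indicator {x. \<sigma> x = y} x = (if \<sigma> x = y then pmf \<mu> \<sigma> else 0)" for \<sigma>
      by simp
    moreover have "(\<Sum>\<sigma>\<in>UNIV. if \<sigma> x = y then pmf \<mu> \<sigma> else 0) = (\<Sum>\<sigma>\<in>(\<lambda>\<sigma>. \<sigma> x) -` {y}. pmf \<mu> \<sigma>)"
      by (subst sum.If_cases) (auto intro: sum.cong)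
    ultimately show ?thesis
      by (simp only: position_law_def pmf_map measure_measure_pmf_finite[OF finite])
  qed
  then have "pmf (bind_pmf \<nu> (position_law \<mu>)) y
      = (\<Sum>x\<in>UNIV. pmf \<nu> x * (\<Sum>\<sigma>\<in>UNIV. pmf \<mu> \<sigma> * indicator {x. \<sigma> x = y} x))"
    by (simp add: pmf_bind integral_measure_pmf_real[of UNIV] mult.commute)
  also have "\<dots> = conv_law \<mu> \<nu> y"
    unfolding conv_law_def sum_distrib_left by (subst sum.swap) (simp add: mult_ac)
  finally show ?thesis .
qed

lemma conv_law_fixed_iff: "conv_law \<mu> \<nu> = pmf \<nu> \<longleftrightarrow> bind_pmf \<nu> (position_law \<mu>) = \<nu>"
  by (auto simp: fun_eq_iff pmf_eq_iff pmf_bind_position_law)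

text \<open>A nonzero entry of the matrix product has a nonzero summand, hence a last edge from some
  \<open>z\<close> to \<open>y\<close>, and this edge is carried by a map in the support of
  \<open>\<mu>\<close>.\<close>

lemma step_prob_pos_if_matrix_power_pos:
  "1 \<le> matrix_power (induced_graph \<mu>) n $ y $ x \<Longrightarrow> 0 < step_prob (position_law \<mu>) n x y"
proof (induction n arbitrary: y)
  case 0
  then show ?case by (simp add: step_prob_0 mat_def split: if_splits)
next
  case (Suc n)
  let ?A = "induced_graph \<mu>"
  have "(\<Sum>z\<in>UNIV. ?A $ y $ z * matrix_power ?A n $ z $ x) \<noteq> 0"
    using Suc.prems by (simp only: matrix_power.simps matrix_matrix_mult_def vec_lambda_beta)
  then obtain z where z: "?A $ y $ z * matrix_power ?A n $ z $ x \<noteq> 0"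
    by (rule sum.not_neutral_contains_not_neutral)
  then have "{\<sigma> \<in> set_pmf \<mu>. \<sigma> z = y} \<noteq> {}"
    by (auto simp: induced_graph_def)
  then have "0 < pmf (position_law \<mu> z) y"
    by (auto simp: pmf_positive_iff position_law_def)
  then have "0 < step_prob (position_law \<mu>) 1 z y" by (simp only: step_prob_1)
  moreover have "0 < step_prob (position_law \<mu>) n x z" using z by (intro Suc.IH) simp
  ultimately have "0 < step_prob (position_law \<mu>) (n + 1) x y" by (metis step_prob_pos_add)
  then show ?case by simp
qed

theorem theorem2p8:
  fixes \<mu> :: "('v::finite \<Rightarrow> 'v) pmf"
  assumes "constant_outdegree (induced_graph \<mu>)"
    and "strongly_connected (induced_graph \<mu>)"
    and "aperiodic (induced_graph \<mu>)"
  shows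
    "(\<exists>(M :: (int \<Rightarrow> 'v \<times> ('v \<Rightarrow> 'v)) measure) X N. random_walk \<mu> M X N) \<and>
     (\<forall>(M :: 'a measure) X N (M' :: 'b measure) X' N'.
        random_walk \<mu> M X N \<and> random_walk \<mu> M' X' N' \<longrightarrow> identical_in_law M X N M' X' N') \<and>
     (\<forall>(M :: 'a measure) X N. random_walk \<mu> M X N \<longrightarrow>
        stationary M X N \<and>
        (\<exists>\<nu> :: 'v pmf.
           (\<forall>k. distr M (count_space UNIV) (X k) = measure_pmf \<nu>) \<and>
           conv_law \<mu> \<nu> = pmf \<nu> \<and>
           (\<forall>\<nu>' :: 'v pmf. conv_law \<mu> \<nu>' = pmf \<nu>' \<longrightarrow> \<nu>' = \<nu>)) \<and>
        (\<forall>E \<in> tail_field M X N. measure M E = 0 \<or> measure M E = 1))"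
proof -
  let ?K = "position_law \<mu>"
  have irr: "\<exists>n. 0 < step_prob ?K n x y" for x y
    using assms(2) step_prob_pos_if_matrix_power_pos[of \<mu> _ y x]
    unfolding strongly_connected_def by blast
  have aper: "Gcd {n. 0 < step_prob ?K n x x} = 1" for x
  proof -
    \<comment> \<open>Every return time of the graph is a return time of the chain, and the gcd of a
      larger set divides that of a smaller one.\<close>
    have "Gcd {n. 0 < step_prob ?K n x x}
        dvd Gcd {n. n \<ge> 1 \<and> matrix_power (induced_graph \<mu>) n $ x $ x \<ge> 1}"
      by (rule Gcd_greatest, rule Gcd_dvd) (auto intro: step_prob_pos_if_matrix_power_pos)
    then show ?thesis using assms(3) unfolding aperiodic_def by simp
  qed
  obtain \<nu> where lim: "\<And>x y. (\<lambda>n. step_prob ?K n x y) \<longlonglongrightarrow> pmf \<nu> y"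
    using finite_markov_convergence[OF irr aper] by blast
  have \<nu>: "bind_pmf \<nu> ?K = \<nu>" by (rule limit_is_stationary[OF lim])
  obtain L where L: "is_path_law \<mu> \<nu> L" by (rule is_path_law_exists[OF \<nu>])
  show ?thesis
  proof (intro conjI allI impI)
    show "\<exists>(M :: (int \<Rightarrow> 'v \<times> ('v \<Rightarrow> 'v)) measure) X N. random_walk \<mu> M X N"
      using random_walk_path_law[OF L] by blast
  next
    fix M :: "'a measure" and X N and M' :: "'b measure" and X' N'
    assume "random_walk \<mu> M X N \<and> random_walk \<mu> M' X' N'"
    then interpret W: random_walk_process \<mu> M X N + W': random_walk_process \<mu> M' X' N'
      by unfold_locales auto
    \<comment> \<open>The two probability spaces are unrelated, but both joint laws are the same
      image of \<open>L\<close>.\<close>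
    show "identical_in_law M X N M' X' N'"
      unfolding identical_in_law_def
      using W.joint_law_shift[OF lim L, of 0] W'.joint_law_shift[OF lim L, of 0] by simp
  next
    fix M :: "'a measure" and X N
    assume walk: "random_walk \<mu> M X N"
    interpret random_walk_process \<mu> M X N by unfold_locales (rule walk)
    show "stationary M X N"
      unfolding stationary_def identical_in_law_def
      using joint_law_shift[OF lim L, of 0] joint_law_shift[OF lim L] by simp
    show "\<exists>\<nu>. (\<forall>k. distr M (count_space UNIV) (X k) = measure_pmf \<nu>) \<and> conv_law \<mu> \<nu> = pmf \<nu> \<and>
        (\<forall>\<nu>'. conv_law \<mu> \<nu>' = pmf \<nu>' \<longrightarrow> \<nu>' = \<nu>)"
      using position_law_eq[OF lim L] \<nu> stationary_eq_limit[OF lim]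
      unfolding conv_law_fixed_iff by blast
    show "\<forall>E\<in>tail_field M X N. prob E = 0 \<or> prob E = 1"
      using tail_trivial[OF lim L] by blast
  qed
qed

end
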